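(* For every $\gamma \in \mathbb{R} \setminus \mathbb{Z}$, the set $\mathbf{Bad}^{\gamma} \setminus \mathbf{Bad}$ has full Hausdorff dimension, i.e. $\dim_H(\mathbf{Bad}^{\gamma} \setminus \mathbf{Bad}) = 1$.
   Context: $\mathbf{Bad}$ is the set of badly approximable real numbers: $\alpha \in \mathbb{R}$ belongs to $\mathbf{Bad}$ if there exists a constant $c = c(\alpha) > 0$ such that $\left|\alpha - \frac{p}{q}\right| > \frac{c}{q^2}$ for all $p \in \mathbb{Z}$ and $q \in \mathbb{Z}\setminus\{0\}$. For $\gamma \in \mathbb{R}$, the set of inhomogeneously badly approximable numbers is $$\mathbf{Bad}^{\gamma} = \left\{\alpha \in \mathbb{R} : \exists\, c = c(\alpha,\gamma) > 0 \text{ such that } \left|\alpha - \frac{p+\gamma}{q}\right| > \frac{c}{q^2} \text{ for all } (p,q) \in \mathbb{Z} \times (\mathbb{Z}\setminus\{0\})\right\}.$$ *)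

theory Defs
  imports "HOL-Analysis.Analysis"
begin

definition Bad :: "real set" where
  "Bad = {\<alpha>. \<exists>c>0. \<forall>p q :: int. q \<noteq> 0 \<longrightarrow>
            \<bar>\<alpha> - of_int p / of_int q\<bar> > c / (of_int q)\<^sup>2}"

definition inhom_Bad :: "real \<Rightarrow> real set" where
  "inhom_Bad \<gamma> = {\<alpha>. \<exists>c>0. \<forall>p q :: int. q \<noteq> 0 \<longrightarrow>
            \<bar>\<alpha> - (of_int p + \<gamma>) / of_int q\<bar> > c / (of_int q)\<^sup>2}"

(* diam(U)^s with the usual conventions: the empty set contributes 0 for every s, and
   diam(U)^0 = 1 for every nonempty U, so that the 0-dimensional measure counts points
   (the library has 0 powr 0 = 0). *)
definition diameter_powr :: "real \<Rightarrow> 'a::metric_space set \<Rightarrow> ennreal" where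
  "diameter_powr s U = (if U = {} then 0 else if s = 0 then 1 else ennreal (diameter U powr s))"

(* Boundedness is required explicitly because the real-valued diameter is unspecified on
   unbounded sets.  Finite covers are included, as the U n may be empty.  If there is no
   admissible cover, the infimum is that of the empty set, i.e. infinity. *)
definition hausdorff_premeasure :: "real \<Rightarrow> real \<Rightarrow> 'a::metric_space set \<Rightarrow> ennreal" where
  "hausdorff_premeasure s \<delta> A =
     Inf {\<Sum>n. diameter_powr s (U n) | U :: nat \<Rightarrow> 'a set.
            A \<subseteq> (\<Union>n. U n) \<and> (\<forall>n. bounded (U n) \<and> diameter (U n) \<le> \<delta>)}"

definition hausdorff_measure :: "real \<Rightarrow> 'a::metric_space set \<Rightarrow> ennreal" where
  "hausdorff_measure s A = (SUP \<delta>\<in>{0<..}. hausdorff_premeasure s \<delta> A)"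

definition hausdorff_dim :: "'a::metric_space set \<Rightarrow> ennreal" where
  "hausdorff_dim A = Inf {ennreal s | s. 0 \<le> s \<and> hausdorff_measure s A = 0}"

end

theory Submission
  imports Defs "HOL-Real_Asymp.Real_Asymp"
begin

text \<open>
  Fix \<open>0 < s < 1\<close>. We build a Cantor set in \<open>inhom_Bad \<gamma> - Bad\<close> of positive \<open>s\<close>-dimensional measure,
  keeping the invariant that at the scale of the current interval neither the lattice of the
  \<open>(q, q \<alpha> - p)\<close> nor its translate of the \<open>(q, q \<alpha> - p - \<gamma>)\<close> has a short nonzero vector.

  In a regular step an interval is cut into \<open>r\<^sup>2\<close> pieces. By the invariant, all failures at the next
  scale come from a single fraction \<open>p / q\<close> and a single \<open>(p + \<gamma>) / q\<close>, so at most \<open>4 r + 4\<close> pieces are lost.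
  In a special step one passes to a much shorter interval next to a fraction \<open>p / q\<close> of comparable scale
  for which \<open>q \<gamma>\<close> is at distance at least \<open>1 / 4\<close> from the integers. This makes \<open>\<alpha>\<close> well
  approximable, while for \<open>p / q\<close> in place of \<open>\<alpha>\<close> the translated lattice stays at distance \<open>1 / (4 q)\<close> from 0.
  Special steps with better and better approximations occur infinitely often, but so
  rarely that the dimension does not drop.
\<close>

section \<open>Hausdorff measure on the line\<close>

text \<open>The approximations must become arbitrarily good while the inhomogeneous constant stays
  fixed, so the factors \<theta> of the special steps, which tend to 0, may enter only the former.
  Lattice avoidance fails at scales between \<open>l\<close> and \<open>\<theta> * l\<close> once
  \<theta> is small, so it is demanded at the current scale alone and restored at the end of the
  step. The inhomogeneous bound has to survive the skipped scales: for \<alpha> near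
  \<open>p / q\<close>, the number \<open>q * (q' * \<alpha> - p' - \<gamma>)\<close> is nearly an
  integer minus \<open>q * \<gamma>\<close>, and \<open>q \<le> C / l\<close>, so the bound is a
  multiple of \<open>l\<close> without \<theta>. That a suitable \<open>q\<close> exists follows
  from the grid invariant itself, so rational \<gamma> is covered as well. Since \<open>C\<close> is
  fixed before \<theta>, a special step can afford to keep a single child: the surplus of the
  regular steps has paid for it in advance.\<close>

lemma hausdorff_measure_zero_real:
  fixes A :: "real set"
  assumes s: "s > 1"
  shows "hausdorff_measure s A = 0"
proof -
  have "hausdorff_premeasure s \<delta> A \<le> ennreal e" if \<delta>: "\<delta> > 0" and e: "e > 0" for \<delta> e
  proof -
    have summ: "summable (\<lambda>n. real (Suc n) powr - s)"
    proof -
      have "summable (\<lambda>n. 1 / (real n) powr s)"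
        using s by (simp add: summable_real_powr_iff powr_minus_divide[symmetric])
      then show ?thesis
        by (subst summable_Suc_iff) (simp add: powr_minus_divide)
    qed
    define Z where "Z = (\<Sum>n. real (Suc n) powr - s)"
    have Z: "Z \<ge> 0" unfolding Z_def by (rule suminf_nonneg[OF summ]) simp
    have "((\<lambda>\<eta>. (2*\<eta>) powr s * Z) \<longlongrightarrow> 0) (at_right 0)"
      using s by real_asymp
    then have "eventually (\<lambda>\<eta>. (2*\<eta>) powr s * Z < e) (at_right 0)"
      using e by (rule order_tendstoD)
    moreover have "eventually (\<lambda>\<eta>. \<eta> < \<delta>) (at_right (0::real))"
      using \<delta> eventually_at_right_field by blast
    moreover have "eventually (\<lambda>\<eta>. \<eta> > 0) (at_right (0::real))"
      by (simp add: eventually_at_right_less)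
    ultimately have "eventually (\<lambda>\<eta>. (2*\<eta>) powr s * Z < e \<and> \<eta> < \<delta> \<and> \<eta> > 0) (at_right 0)"
      by eventually_elim auto
    then obtain \<eta> where \<eta>: "(2*\<eta>) powr s * Z < e" "\<eta> < \<delta>" "\<eta> > 0"
      using eventually_happens[of _ "at_right (0::real)"] by auto
    \<comment> \<open>The harmonic series diverges, so the consecutive gaps of \<open>S\<close> fill
      the half-line, while their \<open>s\<close>-th powers are summable because
      \<open>s > 1\<close>. One cover of the whole line serves every \<open>A\<close>.\<close>
    define S where "S n = \<eta> * harm n" for n
    have SSuc: "S (Suc n) = S n + \<eta> / real (Suc n)" for n
      by (simp add: S_def harm_Suc field_simps)
    have S0: "S 0 = 0" by (simp add: S_def harm_def)
    have Sinf: "filterlim S at_top sequentially"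
      unfolding S_def by (rule filterlim_tendsto_pos_mult_at_top[OF tendsto_const \<eta>(3) harm_at_top])
    have cov: "\<exists>n. S n \<le> x \<and> x \<le> S (Suc n)" if "x \<ge> 0" for x
    proof -
      have "\<exists>n. x < S n"
        using Sinf unfolding filterlim_at_top_dense eventually_sequentially by blast
      then obtain m where m: "x < S m" "\<forall>k<m. \<not> x < S k"
        using exists_least_iff[of "\<lambda>n. x < S n"] by blast
      then obtain n where "m = Suc n" using \<open>x \<ge> 0\<close> S0 by (cases m) auto
      with m show ?thesis by (intro exI[of _ n]) auto
    qed
    define U where "U n = (if even n then {S (n div 2)..S (Suc (n div 2))} else {- S (Suc (n div 2))..- S (n div 2)})" for n
    have diamU: "diameter (U n) = \<eta> / real (Suc (n div 2))" for n
    proof -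
      have "0 \<le> \<eta> / real (Suc (n div 2))" using \<eta> by simp
      then show ?thesis unfolding U_def SSuc by (auto simp: diameter_closed_interval simp del: of_nat_Suc)
    qed
    have ne: "U n \<noteq> {}" for n
    proof -
      have "0 \<le> \<eta> / real (Suc (n div 2))" using \<eta> by simp
      then show ?thesis unfolding U_def SSuc by (auto simp del: of_nat_Suc)
    qed
    have sub: "A \<subseteq> (\<Union>n. U n)"
    proof
      fix x :: real
      show "x \<in> (\<Union>n. U n)"
      proof (cases "x \<ge> 0")
        case True
        then obtain n where "S n \<le> x \<and> x \<le> S (Suc n)" using cov by blast
        then have "x \<in> U (2*n)" by (simp add: U_def)
        then show ?thesis by blast
      next
        case False
        then obtain n where "S n \<le> -x \<and> -x \<le> S (Suc n)" using cov[of "-x"] by auto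
        then have "x \<in> U (2*n+1)" by (simp add: U_def)
        then show ?thesis by blast
      qed
    qed
    have bd: "bounded (U n)" for n by (simp add: U_def)
    have le: "diameter (U n) \<le> \<delta>" for n
    proof -
      have "\<eta> / real (Suc (n div 2)) \<le> \<eta> / 1"
        using \<eta> by (intro divide_left_mono) auto
      then show ?thesis using \<eta> diamU by simp
    qed
    have "hausdorff_premeasure s \<delta> A \<le> (\<Sum>n. diameter_powr s (U n))"
      unfolding hausdorff_premeasure_def by (rule Inf_lower) (use sub bd le in blast)
    also have "\<dots> \<le> (\<Sum>n. ennreal ((2*\<eta>) powr s * real (Suc n) powr - s))"
    proof (rule suminf_le)
      fix n
      have "\<eta> / real (Suc (n div 2)) \<le> 2 * \<eta> / real (Suc n)"
      proof -
        have "n \<le> 2 * (n div 2) + 1" by linarith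
        then have "Suc n \<le> 2 * Suc (n div 2)" by simp
        then have "real (Suc n) \<le> 2 * real (Suc (n div 2))" by (metis of_nat_le_iff of_nat_mult of_nat_numeral)
        then have "\<eta> * real (Suc n) \<le> \<eta> * (2 * real (Suc (n div 2)))" using \<eta> by (intro mult_left_mono) auto
        then show ?thesis by (simp add: divide_simps mult_ac del: of_nat_Suc)
      qed
      then have "diameter (U n) powr s \<le> (2 * \<eta> / real (Suc n)) powr s"
        using s \<eta> diamU by (intro powr_mono2) auto
      also have "\<dots> = (2*\<eta>) powr s * real (Suc n) powr - s"
        using \<eta> by (simp add: powr_divide powr_minus_divide)
      finally show "diameter_powr s (U n) \<le> ennreal ((2*\<eta>) powr s * real (Suc n) powr - s)"
        using s ne by (simp add: diameter_powr_def ennreal_leI)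
    qed auto
    also have "\<dots> = ennreal ((2*\<eta>) powr s * Z)"
      unfolding Z_def suminf_mult[OF summ, symmetric]
      by (rule suminf_ennreal2) (auto intro!: summable_mult summ simp del: of_nat_Suc)
    also have "\<dots> \<le> ennreal e" using \<eta> by (intro ennreal_leI) simp
    finally show ?thesis .
  qed
  then have "hausdorff_premeasure s \<delta> A = 0" if "\<delta> > 0" for \<delta>
    using that ennreal_le_epsilon[of 0 "hausdorff_premeasure s \<delta> A"]
    by (metis add_0 bot.extremum_uniqueI bot_ennreal ennreal_le_epsilon)
  then show ?thesis unfolding hausdorff_measure_def by (auto intro!: SUP_eq_const simp: bot_ennreal)
qed

lemma hausdorff_premeasure_mono:
  "A \<subseteq> B \<Longrightarrow> hausdorff_premeasure s \<delta> A \<le> hausdorff_premeasure s \<delta> B"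
  unfolding hausdorff_premeasure_def by (rule Inf_superset_mono) blast

lemma hausdorff_measure_mono: "A \<subseteq> B \<Longrightarrow> hausdorff_measure s A \<le> hausdorff_measure s B"
  unfolding hausdorff_measure_def by (intro SUP_mono) (auto intro: hausdorff_premeasure_mono)

lemma hausdorff_measure_0_nonempty:
  assumes "A \<noteq> {}"
  shows "hausdorff_measure 0 A \<noteq> 0"
proof -
  have "1 \<le> hausdorff_premeasure 0 1 A"
    unfolding hausdorff_premeasure_def
  proof (rule Inf_greatest, clarify)
    fix U :: "nat \<Rightarrow> 'a set"
    assume "A \<subseteq> (\<Union>n. U n)"
    with assms obtain n where "U n \<noteq> {}" by blast
    then have "1 = diameter_powr 0 (U n)" by (simp add: diameter_powr_def)
    also have "\<dots> \<le> (\<Sum>n. diameter_powr 0 (U n))"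
      using sum_le_suminf[of "\<lambda>n. diameter_powr 0 (U n)" "{n}"] by auto
    finally show "1 \<le> (\<Sum>n. diameter_powr 0 (U n))" .
  qed
  also have "\<dots> \<le> hausdorff_measure 0 A"
    unfolding hausdorff_measure_def by (rule SUP_upper) simp
  finally show ?thesis by auto
qed

lemma hausdorff_measure_empty: "hausdorff_measure s {} = 0"
proof -
  have "hausdorff_premeasure s \<delta> ({} :: 'a set) = 0" if "\<delta> > 0" for \<delta>
  proof -
    have "hausdorff_premeasure s \<delta> ({} :: 'a set) \<le> (\<Sum>n::nat. diameter_powr s ({} :: 'a set))"
      unfolding hausdorff_premeasure_def
      by (rule Inf_lower) (use that in \<open>auto intro!: exI[of _ "\<lambda>_. {}"]\<close>)
    then show ?thesis by (simp add: diameter_powr_def)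
  qed
  then show ?thesis unfolding hausdorff_measure_def by (auto intro!: SUP_eq_const simp: bot_ennreal)
qed

text \<open>An empty set would have measure 0 for \<open>s = 1/2\<close>, so the hypothesis forces a
  point in \<open>A\<close>; with the counting convention this settles \<open>s = 0\<close>, which
  the hypothesis leaves open.\<close>

lemma hausdorff_dim_eq_1:
  fixes A :: "real set"
  assumes pos: "\<And>s. 0 < s \<Longrightarrow> s < 1 \<Longrightarrow> hausdorff_measure s A \<noteq> 0"
  shows "hausdorff_dim A = 1"
proof (rule antisym)
  show "hausdorff_dim A \<le> 1"
  proof (rule ennreal_le_epsilon)
    fix e :: real assume e: "0 < e"
    have "hausdorff_dim A \<le> ennreal (1 + e)"
      unfolding hausdorff_dim_def
    proof (rule Inf_lower)
      have "hausdorff_measure (1 + e) A = 0" using e by (intro hausdorff_measure_zero_real) simp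
      then show "ennreal (1 + e) \<in> {ennreal s |s. 0 \<le> s \<and> hausdorff_measure s A = 0}"
        using e by (intro CollectI exI[of _ "1 + e"]) simp
    qed
    then show "hausdorff_dim A \<le> 1 + ennreal e" using e by simp
  qed
  have "A \<noteq> {}" using pos[of "1/2"] hausdorff_measure_empty by force
  then have "hausdorff_measure 0 A \<noteq> 0" by (rule hausdorff_measure_0_nonempty)
  then show "1 \<le> hausdorff_dim A"
    unfolding hausdorff_dim_def
  proof (intro Inf_greatest, clarify)
    fix s :: real assume "hausdorff_measure 0 A \<noteq> 0" "0 \<le> s" "hausdorff_measure s A = 0"
    then have "\<not> s < 1" using pos[of s] by (cases "s = 0") auto
    then show "1 \<le> ennreal s" by simp
  qed
qed

section \<open>Hausdorff measure of homogeneous Cantor sets\<close>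

text \<open>Pigeonhole: the half-open cells of length \<open>l\<close> starting at \<open>u\<close>
  hold at most one point of \<open>S\<close> each.\<close>

lemma card_separated_le:
  fixes S :: "real set"
  assumes "finite S" and l: "0 < l" and sep: "\<And>x y. x \<in> S \<Longrightarrow> y \<in> S \<Longrightarrow> x \<noteq> y \<Longrightarrow> l \<le> \<bar>x - y\<bar>"
    and sub: "S \<subseteq> {u<..<u + real k * l}"
  shows "card S \<le> k"
proof -
  let ?f = "\<lambda>x. nat \<lfloor>(x - u) / l\<rfloor>"
  have inj: "inj_on ?f S"
  proof (rule inj_onI, rule ccontr)
    fix x y assume xy: "x \<in> S" "y \<in> S" "?f x = ?f y" "x \<noteq> y"
    then have "x > u" "y > u" using sub by auto
    then have "0 \<le> (x-u)/l" "0 \<le> (y-u)/l" using l by auto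
    then have eq: "\<lfloor>(x-u)/l\<rfloor> = \<lfloor>(y-u)/l\<rfloor>" using xy(3) by (simp add: nat_eq_iff)
    then have "\<bar>(x-u)/l - (y-u)/l\<bar> < 1" by linarith
    then have "\<bar>x - y\<bar> < l" using l
      by (simp add: diff_divide_distrib[symmetric] abs_divide field_simps)
    then show False using sep[OF xy(1,2,4)] by simp
  qed
  have "?f ` S \<subseteq> {..<k}"
  proof clarify
    fix x assume "x \<in> S"
    then have "x < u + real k * l" "x > u" using sub by auto
    then have "(x-u)/l < real k" "(x-u)/l > 0" using l by (auto simp: field_simps)
    then show "?f x < k" by linarith
  qed
  then have "card (?f ` S) \<le> k" using card_mono[of "{..<k}"] by force
  then show ?thesis using card_image[OF inj] by simp
qed

text \<open>
  A tree of intervals \<open>[x, x + L n]\<close>, indexed by left endpoints: every node of level \<open>n\<close> has exactly \<open>M n\<close>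
  children, so that a level-\<open>n\<close> node carries the mass \<open>1 / (M 0 * \<dots> * M (n - 1))\<close>.
\<close>

locale interval_tree =
  fixes L :: "nat \<Rightarrow> real" and M :: "nat \<Rightarrow> nat" and P :: "nat \<Rightarrow> real \<Rightarrow> bool"
    and ch :: "nat \<Rightarrow> real \<Rightarrow> real set" and x0 :: real
  assumes L_pos: "\<And>n. 0 < L n"
    and root: "P 0 x0"
    and ch_finite: "\<And>n x. P n x \<Longrightarrow> finite (ch n x)"
    and ch_card: "\<And>n x. P n x \<Longrightarrow> card (ch n x) = M n"
    and ch_P: "\<And>n x y. P n x \<Longrightarrow> y \<in> ch n x \<Longrightarrow> P (Suc n) y"
    and ch_sub: "\<And>n x y. P n x \<Longrightarrow> y \<in> ch n x \<Longrightarrow> x \<le> y \<and> y + L (Suc n) \<le> x + L n"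
    and ch_sep: "\<And>n x y z. P n x \<Longrightarrow> y \<in> ch n x \<Longrightarrow> z \<in> ch n x \<Longrightarrow> y \<noteq> z \<Longrightarrow> L (Suc n) \<le> \<bar>y - z\<bar>"
begin

primrec nodes :: "nat \<Rightarrow> real set" where
  "nodes 0 = {x0}"
| "nodes (Suc n) = (\<Union>x\<in>nodes n. ch n x)"

definition ivl :: "nat \<Rightarrow> real \<Rightarrow> real set" where
  "ivl n x = {x..x + L n}"

definition level :: "nat \<Rightarrow> real set" where
  "level n = (\<Union>x\<in>nodes n. ivl n x)"

definition limit_set :: "real set" where
  "limit_set = (\<Inter>n. level n)"

lemma nodes_P: "x \<in> nodes n \<Longrightarrow> P n x"
  by (induction n arbitrary: x) (auto simp: root intro: ch_P)

lemma finite_nodes: "finite (nodes n)"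
  by (induction n) (auto intro!: ch_finite nodes_P)

lemma nodes_sep: "x \<in> nodes n \<Longrightarrow> y \<in> nodes n \<Longrightarrow> x \<noteq> y \<Longrightarrow> L n \<le> \<bar>x - y\<bar>"
proof (induction n arbitrary: x y)
  case (Suc n)
  then obtain u v where uv: "u \<in> nodes n" "x \<in> ch n u" "v \<in> nodes n" "y \<in> ch n v" by auto
  show ?case
  proof (cases "u = v")
    case True
    then show ?thesis using uv Suc.prems ch_sep nodes_P by metis
  next
    case False
    then have "L n \<le> \<bar>u - v\<bar>" using Suc.IH uv by blast
    then show ?thesis
      using ch_sub[OF nodes_P[OF uv(1)] uv(2)] ch_sub[OF nodes_P[OF uv(3)] uv(4)] L_pos[of "Suc n"]
      by (auto simp: abs_if split: if_splits)
  qed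
qed simp

lemma ivl_child: "x \<in> nodes n \<Longrightarrow> y \<in> ch n x \<Longrightarrow> ivl (Suc n) y \<subseteq> ivl n x"
  using ch_sub[OF nodes_P] by (fastforce simp: ivl_def)

lemma ch_disjoint: 
  assumes "x \<in> nodes n" "y \<in> nodes n" "x \<noteq> y" shows "ch n x \<inter> ch n y = {}"
proof (rule ccontr)
  assume "ch n x \<inter> ch n y \<noteq> {}"
  then obtain z where z: "z \<in> ch n x" "z \<in> ch n y" by auto
  show False
    using ch_sub[OF nodes_P[OF assms(1)] z(1)] ch_sub[OF nodes_P[OF assms(2)] z(2)]
      nodes_sep[OF assms] L_pos[of "Suc n"] by linarith
qed

lemma card_nodes: "card (nodes n) = (\<Prod>i<n. M i)"
proof (induction n)
  case (Suc n)
  have "card (nodes (Suc n)) = (\<Sum>x\<in>nodes n. card (ch n x))"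
    unfolding nodes.simps
    by (rule card_UN_disjoint) (auto intro: finite_nodes ch_finite nodes_P dest: ch_disjoint)
  also have "\<dots> = (\<Sum>x\<in>nodes n. M n)" by (intro sum.cong) (auto intro: ch_card nodes_P)
  finally show ?case using Suc by simp
qed simp

lemma level_antimono: "m \<le> n \<Longrightarrow> level n \<subseteq> level m"
proof (rule lift_Suc_antimono_le[of level])
  show "level (Suc n) \<le> level n" for n
    using ivl_child by (fastforce simp: level_def)
qed

lemma compact_level: "compact (level n)"
  unfolding level_def by (intro compact_UN finite_nodes) (auto simp: ivl_def)

lemma limit_set_P: "\<alpha> \<in> limit_set \<Longrightarrow> \<exists>x. P n x \<and> x \<le> \<alpha> \<and> \<alpha> \<le> x + L n"
  unfolding limit_set_def level_def ivl_def using nodes_P by fastforce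

text \<open>Compactness reduces an open cover of the Cantor set to a cover of one finite level, so
  that counting intervals replaces the construction of a measure.\<close>

lemma level_subset_open:
  assumes "open V" "limit_set \<subseteq> V"
  shows "\<exists>n. level n \<subseteq> V"
proof (rule ccontr)
  assume c: "\<nexists>n. level n \<subseteq> V"
  have "\<Inter>(range (\<lambda>n. level n - V)) \<noteq> {}"
  proof (rule compact_nest)
    show "compact (level n - V)" for n by (intro compact_diff compact_level assms)
    show "level n - V \<noteq> {}" for n using c by blast
    show "level n - V \<subseteq> level m - V" if "m \<le> n" for m n using level_antimono[OF that] by blast
  qed
  then show False using assms(2) by (auto simp: limit_set_def)
qed

text \<open>\<open>hits n V / card (nodes n)\<close> is an upper estimate, nonincreasing in
  \<open>n\<close>, for the mass that the uniform measure on the tree would give to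
  \<open>V\<close>.\<close>

definition hits :: "nat \<Rightarrow> real set \<Rightarrow> nat" where
  "hits n V = card {x\<in>nodes n. ivl n x \<inter> V \<noteq> {}}"

lemma hits_le:
  assumes "n \<le> m"
  shows "hits m V \<le> hits n V * (\<Prod>i=n..<m. M i)"
  using assms
proof (induction m rule: dec_induct)
  case (step m)
  have "hits (Suc m) V \<le> card (\<Union>x\<in>{x\<in>nodes m. ivl m x \<inter> V \<noteq> {}}. ch m x)"
    unfolding hits_def
  proof (rule card_mono)
    show "finite (\<Union>x\<in>{x\<in>nodes m. ivl m x \<inter> V \<noteq> {}}. ch m x)"
      using finite_nodes by (auto intro!: ch_finite nodes_P)
    show "{x \<in> nodes (Suc m). ivl (Suc m) x \<inter> V \<noteq> {}} \<subseteq> (\<Union>x\<in>{x\<in>nodes m. ivl m x \<inter> V \<noteq> {}}. ch m x)"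
      using ivl_child by fastforce
  qed
  also have "\<dots> \<le> (\<Sum>x\<in>{x\<in>nodes m. ivl m x \<inter> V \<noteq> {}}. card (ch m x))"
    by (rule card_UN_le) (use finite_nodes in auto)
  also have "\<dots> = (\<Sum>x\<in>{x\<in>nodes m. ivl m x \<inter> V \<noteq> {}}. M m)"
    by (intro sum.cong) (auto intro: ch_card nodes_P)
  also have "\<dots> = hits m V * M m" by (simp add: hits_def)
  also have "\<dots> \<le> hits n V * (\<Prod>i=n..<m. M i) * M m" using step.IH by simp
  also have "\<dots> = hits n V * (\<Prod>i=n..<Suc m. M i)" using step.hyps by (simp add: prod.atLeastLessThan_Suc)
  finally show ?case .
qed simp

lemma hits_ball:
  assumes "0 < r" "r \<le> L n"
  shows "hits n {u - r<..<u + r} \<le> 4"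
  unfolding hits_def
proof (rule card_separated_le)
  \<comment> \<open>The left endpoint of an interval that meets the ball lies between
    \<open>u - r - L n\<close> and \<open>u + r\<close>, and \<open>r \<le> L n\<close>.\<close>
  show "{x \<in> nodes n. ivl n x \<inter> {u - r<..<u + r} \<noteq> {}} \<subseteq> {u - 2 * L n <..<(u - 2 * L n) + real 4 * L n}"
    using assms L_pos[of n] by (auto simp: ivl_def)
qed (use finite_nodes L_pos nodes_sep in auto)

text \<open>The mass distribution principle. A ball with \<open>L (Suc n) < r \<le> L n\<close>
  meets at most four intervals of level \<open>n\<close>, so its mass is at most 4 over the number
  of nodes there; this is why \<open>mass\<close> pairs the count at level \<open>n\<close> with the
  length at level \<open>Suc n\<close>.\<close>

theorem hausdorff_measure_limit_set:
  assumes s: "0 < s" and c: "0 < c" and mass: "\<And>n. c \<le> real (\<Prod>i<n. M i) * L (Suc n) powr s"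
    and mono: "\<And>n. L (Suc n) \<le> L n" and lim: "L \<longlonglongrightarrow> 0"
  shows "hausdorff_measure s limit_set \<noteq> 0"
proof -
  let ?N = "\<lambda>n. real (card (nodes n))"
  have N_pos: "0 < ?N n" for n
  proof (rule ccontr)
    assume "\<not> 0 < ?N n"
    then have "(\<Prod>i<n. M i) = 0" by (metis card_nodes gr0I of_nat_0_less_iff)
    then have "real (\<Prod>i<n. M i) = 0" by (metis of_nat_0)
    then show False using mass[of n] c by (metis mult_zero_left not_le)
  qed
  \<comment> \<open>\<open>c / 4\<close> accounts for the four intervals met by a small ball,
    \<open>L 0 powr s\<close> for balls larger than the root interval.\<close>
  define c' where "c' = min (c / 4) (L 0 powr s)"
  have c': "0 < c'" using c L_pos[of 0] by (simp add: c'_def)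
  have key: "\<exists>n0. \<forall>n\<ge>n0. c' * real (hits n {u - r<..<u + r}) \<le> ?N n * r powr s" if r: "0 < r" for u r
  proof (cases "r \<le> L 0")
    case True
    have "\<exists>n. L n < r"
      using order_tendstoD(2)[OF lim r] by (auto simp: eventually_sequentially)
    then obtain k where k: "L k < r" "\<forall>j<k. \<not> L j < r"
      using exists_least_iff[of "\<lambda>n. L n < r"] by blast
    then obtain n where n: "k = Suc n" using True by (cases k) auto
    have rn: "L (Suc n) < r" "r \<le> L n" using k n by auto
    have "c' * real (hits m {u - r<..<u + r}) \<le> ?N m * r powr s" if "n \<le> m" for m
    proof -
      have N: "card (nodes m) = card (nodes n) * (\<Prod>i=n..<m. M i)"
        unfolding card_nodes using that
        by (metis atLeast0LessThan le0 prod.atLeastLessThan_concat)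
      have "hits m {u - r<..<u + r} \<le> 4 * (\<Prod>i=n..<m. M i)"
        using hits_le[OF that, of "{u - r<..<u + r}"] hits_ball[OF r rn(2), of u]
        by (meson le_trans mult_le_mono1)
      then have "real (hits m {u - r<..<u + r}) \<le> 4 * real (\<Prod>i=n..<m. M i)"
        by (metis of_nat_le_iff of_nat_mult of_nat_numeral)
      then have "c' * real (hits m {u - r<..<u + r}) \<le> c / 4 * (4 * real (\<Prod>i=n..<m. M i))"
        using c' by (intro mult_mono) (auto simp: c'_def)
      also have "\<dots> \<le> ?N n * L (Suc n) powr s * real (\<Prod>i=n..<m. M i)"
        using mult_right_mono[OF mass[of n] of_nat_0_le_iff[of "\<Prod>i=n..<m. M i"]]
        unfolding card_nodes by simp
      also have "\<dots> = ?N m * L (Suc n) powr s" by (simp add: N)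
      also have "\<dots> \<le> ?N m * r powr s"
        using rn s L_pos[of "Suc n"] by (intro mult_left_mono powr_mono2) auto
      finally show ?thesis .
    qed
    then show ?thesis by blast
  next
    case False
    have "c' * real (hits n {u - r<..<u + r}) \<le> ?N n * r powr s" for n
    proof -
      have "hits n {u - r<..<u + r} \<le> card (nodes n)"
        unfolding hits_def by (intro card_mono finite_nodes) auto
      moreover have "c' \<le> r powr s"
        using False s L_pos[of 0] powr_mono2[of s "L 0" r] by (simp add: c'_def)
      ultimately have "c' * real (hits n {u - r<..<u + r}) \<le> r powr s * ?N n"
        using c' by (intro mult_mono) auto
      then show ?thesis by (simp add: mult.commute)
    qed
    then show ?thesis by blast
  qed
  have "ennreal (c' / 2) \<le> hausdorff_premeasure s 1 limit_set"
    unfolding hausdorff_premeasure_def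
  proof (rule Inf_greatest, clarify)
    fix U :: "nat \<Rightarrow> real set"
    assume cov: "limit_set \<subseteq> (\<Union>n. U n)" and bd: "\<forall>n. bounded (U n) \<and> diameter (U n) \<le> 1"
    define I where "I = {n. U n \<noteq> {}}"
    define d where "d n = diameter (U n)" for n
    have d0: "0 \<le> d n" for n using bd diameter_ge_0 by (auto simp: d_def)
    \<comment> \<open>Radii strictly above the diameters turn the cover into open balls, also for
      singletons; the extra cost sums to at most \<open>c' / 4\<close>.\<close>
    have "\<exists>r. d n < r \<and> r powr s < d n powr s + c' / 4 * (1/2) ^ Suc n" for n
    proof -
      have "((\<lambda>r. r powr s) \<longlongrightarrow> d n powr s) (at_right (d n))"
        using s d0[of n] eventually_at_right_less[of "d n"]
        by (intro tendsto_powr' tendsto_intros) (auto elim!: eventually_mono)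
      then have "eventually (\<lambda>r. r powr s < d n powr s + c' / 4 * (1/2) ^ Suc n) (at_right (d n))"
        by (rule order_tendstoD) (use c' in auto)
      moreover have "eventually (\<lambda>r. d n < r) (at_right (d n))" by (simp add: eventually_at_right_less)
      ultimately have "eventually (\<lambda>r. d n < r \<and> r powr s < d n powr s + c' / 4 * (1/2) ^ Suc n) (at_right (d n))"
        by eventually_elim auto
      then show ?thesis using eventually_happens[of _ "at_right (d n)"] by auto
    qed
    then obtain r where r: "\<And>n. d n < r n" "\<And>n. r n powr s < d n powr s + c' / 4 * (1/2) ^ Suc n"
      by metis
    have "\<forall>n\<in>I. \<exists>u. u \<in> U n" by (auto simp: I_def)
    then obtain u where u: "\<And>n. n \<in> I \<Longrightarrow> u n \<in> U n" by metis
    define V where "V n = {u n - r n<..<u n + r n}" for n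
    have UV: "U n \<subseteq> V n" if "n \<in> I" for n
    proof
      fix x assume "x \<in> U n"
      then have "dist x (u n) \<le> d n"
        using bd u[OF that] unfolding d_def by (intro diameter_bounded_bound) auto
      then show "x \<in> V n" using r(1)[of n] by (auto simp: V_def dist_real_def)
    qed
    have "limit_set \<subseteq> (\<Union>n\<in>I. V n)" using cov UV by (fastforce simp: I_def)
    then obtain n1 where "level n1 \<subseteq> (\<Union>n\<in>I. V n)"
      using level_subset_open[of "\<Union>n\<in>I. V n"] unfolding V_def by (meson open_UN open_greaterThanLessThan)
    then obtain J where J: "J \<subseteq> I" "finite J" "level n1 \<subseteq> (\<Union>n\<in>J. V n)"
      using compactE_image[OF compact_level, of I V n1] by (auto simp: V_def)
    have "\<forall>j. \<exists>n0. \<forall>n\<ge>n0. c' * real (hits n (V j)) \<le> ?N n * r j powr s"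
      unfolding V_def by (intro allI key) (use d0 r(1) in \<open>metis le_less_trans\<close>)
    then obtain n0 where n0: "\<And>j n. n \<ge> n0 j \<Longrightarrow> c' * real (hits n (V j)) \<le> ?N n * r j powr s" by metis
    define m where "m = Max (insert n1 (n0 ` J))"
    have m: "n1 \<le> m" "\<And>j. j \<in> J \<Longrightarrow> n0 j \<le> m" using J(2) by (auto simp: m_def)
    have "nodes m \<subseteq> (\<Union>j\<in>J. {x\<in>nodes m. ivl m x \<inter> V j \<noteq> {}})"
    proof
      fix x assume x: "x \<in> nodes m"
      then have "x \<in> level m" using L_pos[of m] by (auto simp: level_def ivl_def intro!: bexI[of _ x])
      then obtain j where "j \<in> J" "x \<in> V j" using J level_antimono[OF m(1)] by blast
      moreover have "x \<in> ivl m x" using L_pos[of m] by (simp add: ivl_def)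
      ultimately show "x \<in> (\<Union>j\<in>J. {x\<in>nodes m. ivl m x \<inter> V j \<noteq> {}})" using x by blast
    qed
    then have "card (nodes m) \<le> card (\<Union>j\<in>J. {x\<in>nodes m. ivl m x \<inter> V j \<noteq> {}})"
      using J(2) finite_nodes by (intro card_mono) auto
    also have "\<dots> \<le> (\<Sum>j\<in>J. hits m (V j))"
      unfolding hits_def by (rule card_UN_le) (rule J(2))
    finally have "?N m \<le> (\<Sum>j\<in>J. real (hits m (V j)))"
      by (metis of_nat_le_iff of_nat_sum)
    then have "c' * ?N m \<le> (\<Sum>j\<in>J. c' * real (hits m (V j)))"
      using c' by (simp add: sum_distrib_left[symmetric])
    also have "\<dots> \<le> (\<Sum>j\<in>J. ?N m * r j powr s)"
      by (intro sum_mono n0 m)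
    finally have "c' * ?N m \<le> ?N m * (\<Sum>j\<in>J. r j powr s)" by (simp add: sum_distrib_left)
    then have "c' \<le> (\<Sum>j\<in>J. r j powr s)" using N_pos[of m] by (simp add: mult.commute)
    also have "\<dots> \<le> (\<Sum>j\<in>J. d j powr s + c' / 4 * (1/2) ^ Suc j)"
      by (intro sum_mono less_imp_le r(2))
    also have "\<dots> = (\<Sum>j\<in>J. d j powr s) + c' / 4 * (\<Sum>j\<in>J. (1/2) ^ Suc j)"
      by (simp add: sum.distrib sum_distrib_left)
    also have "(\<Sum>j\<in>J. (1/2::real) ^ Suc j) \<le> 1"
    proof -
      have "(\<Sum>j\<in>J. (1/2::real) ^ Suc j) \<le> (\<Sum>j. (1/2) ^ Suc j)"
        by (rule sum_le_suminf) (use J(2) power_half_series in \<open>auto simp: sums_iff\<close>)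
      also have "\<dots> = 1" using power_half_series by (simp add: sums_iff)
      finally show ?thesis .
    qed
    finally have "c' / 2 \<le> (\<Sum>j\<in>J. d j powr s)" using c' by simp
    then have "ennreal (c' / 2) \<le> ennreal (\<Sum>j\<in>J. d j powr s)" by (rule ennreal_leI)
    also have "\<dots> = (\<Sum>j\<in>J. ennreal (d j powr s))" by simp
    also have "\<dots> = (\<Sum>j\<in>J. diameter_powr s (U j))"
      using J(1) s by (intro sum.cong refl) (auto simp: diameter_powr_def d_def I_def)
    also have "\<dots> \<le> (\<Sum>j. diameter_powr s (U j))"
      using J(2) by (intro sum_le_suminf) auto
    finally show "ennreal (c' / 2) \<le> (\<Sum>j. diameter_powr s (U j))" .
  qed
  also have "\<dots> \<le> hausdorff_measure s limit_set"
    unfolding hausdorff_measure_def by (rule SUP_upper) simp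
  finally show ?thesis using c' by auto
qed

end

section \<open>The choice of the parameters\<close>

text \<open>
  \<open>W n\<close> stands for \<open>N\<^sub>n L\<^sub>n\<^sup>s\<close>, the normalised number of intervals. The \<open>j\<close>-th expensive step, of cost
  \<open>\<phi> j\<close>, is taken as soon as it keeps \<open>W\<close> above 1; until then \<open>W\<close> grows by the factor \<open>\<rho>\<close>.
\<close>

lemma schedule_exists:
  fixes \<phi> :: "nat \<Rightarrow> real" and \<rho> :: real
  assumes \<rho>: "1 < \<rho>" and \<phi>: "\<And>j. 0 < \<phi> j"
  obtains sp :: "nat \<Rightarrow> bool" and j :: "nat \<Rightarrow> nat" and W :: "nat \<Rightarrow> real"
  where "W 0 = 1" "\<And>n. 1 \<le> W n"
    "\<And>n. W (Suc n) = W n * (if sp n then \<phi> (j n) else \<rho>)"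
    "\<And>k. \<exists>n. sp n \<and> j n = k"
proof -
  define st where "st = rec_nat (0::nat, 1::real)
    (\<lambda>_ (j, W). if 1 \<le> W * \<phi> j then (Suc j, W * \<phi> j) else (j, W * \<rho>))"
  define j where "j n = fst (st n)" for n
  define W where "W n = snd (st n)" for n
  define sp where "sp n \<longleftrightarrow> 1 \<le> W n * \<phi> (j n)" for n
  have j0: "j 0 = 0" and W0: "W 0 = 1" by (simp_all add: j_def W_def st_def)
  have jS: "j (Suc n) = (if sp n then Suc (j n) else j n)"
    and WS: "W (Suc n) = W n * (if sp n then \<phi> (j n) else \<rho>)" for n
    by (simp_all add: j_def W_def sp_def st_def case_prod_unfold)
  have W1: "1 \<le> W n" for n
  proof (induction n)
    case (Suc n)
    then show ?case using \<rho> mult_mono[of 1 "W n" 1 \<rho>] by (auto simp: WS sp_def)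
  qed (simp add: W0)
  \<comment> \<open>Without a further expensive step \<open>j\<close> is frozen while
    \<open>W\<close> grows geometrically, so \<open>W * \<phi> j\<close> reaches 1 after
    all.\<close>
  have reach: "\<exists>n\<ge>n0. sp n" for n0
  proof (rule ccontr)
    assume "\<not> ?thesis"
    then have no: "\<not> sp n" if "n \<ge> n0" for n using that by auto
    have ji: "j (n0 + i) = j n0" for i by (induction i) (auto simp: jS no)
    have "W (n0 + i) = W n0 * \<rho> ^ i" for i by (induction i) (auto simp: WS no)
    moreover obtain i where "1 / \<phi> (j n0) < \<rho> ^ i" using real_arch_pow[OF \<rho>] by blast
    moreover have "1 * \<rho> ^ i \<le> W n0 * \<rho> ^ i" using \<rho> by (intro mult_right_mono W1) simp
    ultimately have "1 / \<phi> (j n0) \<le> W (n0 + i)" by simp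
    then have "sp (n0 + i)" using \<phi>[of "j n0"] by (simp add: sp_def ji pos_divide_le_eq)
    then show False using no by simp
  qed
  have "\<exists>n. sp n \<and> j n = k" for k
  proof (induction k)
    case 0
    obtain n where "sp n" "\<forall>m<n. \<not> sp m" using reach exists_least_iff[of sp] by blast
    moreover have "j m = 0" if "m \<le> n" for m
      using that \<open>\<forall>m<n. \<not> sp m\<close> by (induction m) (auto simp: j0 jS)
    ultimately show ?case by blast
  next
    case (Suc k)
    then obtain n where n: "sp n" "j n = k" by blast
    obtain m where m: "m \<ge> Suc n" "sp m" "\<forall>i<m. \<not> (i \<ge> Suc n \<and> sp i)"
      using reach[of "Suc n"] exists_least_iff[of "\<lambda>i. i \<ge> Suc n \<and> sp i"] by blast
    have "j i = Suc k" if "Suc n \<le> i" "i \<le> m" for i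
      using that
    proof (induction i rule: dec_induct)
      case base then show ?case using n by (simp add: jS)
    next
      case (step i) then show ?case using m by (simp add: jS)
    qed
    with m show ?case by blast
  qed
  then show thesis using that W0 W1 WS by blast
qed

text \<open>A loss linear in \<open>r\<close> out of \<open>r\<^sup>2\<close> pieces is negligible:
  as \<open>s < 1\<close>, the number that remains beats \<open>r\<close> to the power
  \<open>2 * s\<close> for large \<open>r\<close>. The role of \<epsilon> will be played by a lower
  bound for the distance from \<gamma> to the integers, and \<open>r \<ge> 6\<close> keeps the
  natural subtraction from truncating.\<close>

lemma ex_branching_number:
  fixes s \<epsilon> :: real
  assumes s: "s < 1" and e: "\<epsilon> > 0"
  obtains r :: nat where "r \<ge> 6" "1 / (6 * (real r)\<^sup>2) < \<epsilon>" "(real r)\<^sup>2 powr s < real (r\<^sup>2 - (4 * r + 4))"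
proof -
  have "((\<lambda>r::nat. real r powr (2 * s) / (real r ^ 2 - (4 * real r + 4))) \<longlongrightarrow> 0) sequentially"
    using s by real_asymp
  then have "eventually (\<lambda>r::nat. real r powr (2 * s) / (real r ^ 2 - (4 * real r + 4)) < 1) sequentially"
    by (rule order_tendstoD) simp
  moreover have "((\<lambda>r::nat. 1 / (6 * (real r)\<^sup>2)) \<longlongrightarrow> 0) sequentially"
    by real_asymp
  then have "eventually (\<lambda>r::nat. 1 / (6 * (real r)\<^sup>2) < \<epsilon>) sequentially"
    by (rule order_tendstoD) (rule e)
  moreover have "eventually (\<lambda>r::nat. r \<ge> 6) sequentially" by (rule eventually_ge_at_top)
  ultimately have "eventually (\<lambda>r::nat. r \<ge> 6 \<and> 1 / (6 * (real r)\<^sup>2) < \<epsilon> \<and>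
      real r powr (2 * s) / (real r ^ 2 - (4 * real r + 4)) < 1) sequentially"
    by eventually_elim auto
  then obtain r :: nat where r: "r \<ge> 6" "1 / (6 * (real r)\<^sup>2) < \<epsilon>"
      "real r powr (2 * s) / (real r ^ 2 - (4 * real r + 4)) < 1"
    using eventually_happens[of _ sequentially] by auto
  have "6 * r \<le> r\<^sup>2" using r(1) by (simp add: power2_eq_square)
  then have le: "4 * r + 4 < r\<^sup>2" using r(1) by linarith
  then have eq: "real (r\<^sup>2 - (4 * r + 4)) = real r ^ 2 - (4 * real r + 4)" by (simp add: of_nat_diff)
  have "real (r\<^sup>2 - (4 * r + 4)) > 0" using le by (simp del: of_nat_diff)
  then have "real r powr (2 * s) < real (r\<^sup>2 - (4 * r + 4))"
    using r(3) eq by (simp add: field_simps)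
  moreover have "(real r)\<^sup>2 powr s = real r powr (2 * s)"
    using r(1) powr_powr[of "real r" 2 s] by simp
  ultimately show thesis using r(1,2) by (intro that[of r]) auto
qed

section \<open>Regular steps\<close>

text \<open>
  Both predicates concern one scale only: an interval of length \<open>l\<^sup>2\<close> sees denominators of size
  \<open>1 / l\<close>. They say that the lattice of the vectors \<open>(q, q \<alpha> - p)\<close>, respectively its translate by
  \<open>(0, -\<gamma>)\<close>, has no short vector after rescaling. In the second one \<open>q = 0\<close> is allowed on purpose:
  this case encodes that \<open>\<gamma>\<close> is not near an integer.
\<close>

definition lattice_avoids :: "real \<Rightarrow> real \<Rightarrow> real \<Rightarrow> bool" where
  "lattice_avoids a l \<alpha> \<longleftrightarrow>
     (\<forall>p q :: int. q \<noteq> 0 \<longrightarrow> \<bar>of_int q\<bar> * l \<le> a \<longrightarrow> a * l < \<bar>of_int q * \<alpha> - of_int p\<bar>)"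

definition grid_avoids :: "real \<Rightarrow> real \<Rightarrow> real \<Rightarrow> real \<Rightarrow> bool" where
  "grid_avoids \<gamma> b l \<alpha> \<longleftrightarrow>
     (\<forall>p q :: int. \<bar>of_int q\<bar> * l \<le> b \<longrightarrow> b * l < \<bar>of_int q * \<alpha> - of_int p - \<gamma>\<bar>)"

text \<open>A vector that is short at scale \<open>l / r\<close> but not at scale \<open>l\<close>
  must have \<open>a < \<bar>q\<bar> * l\<close>; dividing its second coordinate by so large a
  \<open>q\<close> locates \<alpha>.\<close>

lemma lattice_bad_close:
  assumes l: "0 < l" and r: "1 \<le> r" and a: "0 < a"
    and av: "lattice_avoids a l \<alpha>" and q: "q \<noteq> 0" "\<bar>of_int q\<bar> * (l / r) \<le> a"
    and bad: "\<bar>of_int q * \<alpha> - of_int p\<bar> \<le> a * (l / r)"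
  shows "\<bar>\<alpha> - of_int p / of_int q\<bar> < l\<^sup>2 / r"
proof -
  have "a * (l / r) \<le> a * l" using l r a by (simp add: field_simps)
  then have "a < \<bar>of_int q\<bar> * l"
    using av q(1) bad unfolding lattice_avoids_def by (meson not_le order_trans)
  then have "a * (l / r) < \<bar>of_int q\<bar> * l * (l / r)" using l r by (intro mult_strict_right_mono) auto
  then have "\<bar>of_int q * \<alpha> - of_int p\<bar> < \<bar>of_int q\<bar> * (l\<^sup>2 / r)"
    using bad by (simp add: power2_eq_square mult_ac)
  also have "\<bar>of_int q * \<alpha> - of_int p\<bar> = \<bar>of_int q\<bar> * \<bar>\<alpha> - of_int p / of_int q\<bar>"
    using q(1) by (simp add: abs_mult[symmetric] right_diff_distrib)
  finally show ?thesis by (rule mult_left_less_imp_less) simp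
qed

text \<open>As for the lattice; here \<open>q = 0\<close> is ruled out by grid avoidance at scale
  \<open>l\<close>, which keeps \<gamma> itself away from the integers.\<close>

lemma grid_bad_close:
  assumes l: "0 < l" and r: "1 \<le> r" and b: "0 < b"
    and av: "grid_avoids \<gamma> b l \<alpha>"
    and bad: "\<bar>of_int q * \<alpha> - of_int p - \<gamma>\<bar> \<le> b * (l / r)"
  shows "\<bar>\<alpha> - (of_int p + \<gamma>) / of_int q\<bar> < l\<^sup>2 / r"
proof -
  have "b * (l / r) \<le> b * l" using l r b by (simp add: field_simps)
  then have "b < \<bar>of_int q\<bar> * l"
    using av bad unfolding grid_avoids_def by (meson not_le order_trans)
  moreover from this have q: "q \<noteq> 0" using b by auto
  ultimately have "b * (l / r) < \<bar>of_int q\<bar> * l * (l / r)" using l r by (intro mult_strict_right_mono) auto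
  then have "\<bar>of_int q * \<alpha> - of_int p - \<gamma>\<bar> < \<bar>of_int q\<bar> * (l\<^sup>2 / r)"
    using bad by (simp add: power2_eq_square mult_ac)
  also have "\<bar>of_int q * \<alpha> - of_int p - \<gamma>\<bar> = \<bar>of_int q\<bar> * \<bar>\<alpha> - (of_int p + \<gamma>) / of_int q\<bar>"
    using q by (simp add: abs_mult[symmetric] right_diff_distrib diff_diff_eq)
  finally show ?thesis by (rule mult_left_less_imp_less) simp
qed

lemma int_fraction_diff:
  fixes p q p' q' :: int
  assumes "q \<noteq> 0" "q' \<noteq> 0" "p * q' \<noteq> p' * q"
  shows "1 \<le> \<bar>of_int q\<bar> * \<bar>of_int q'\<bar> * \<bar>of_int p / of_int q - of_int p' / of_int q' :: real\<bar>"
proof -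
  have "of_int p / of_int q - of_int p' / of_int q' = (of_int (p * q' - p' * q) :: real) / (of_int q * of_int q')"
    using assms by (simp add: field_simps)
  then have "\<bar>of_int q\<bar> * \<bar>of_int q'\<bar> * \<bar>of_int p / of_int q - of_int p' / of_int q' :: real\<bar> = \<bar>of_int (p * q' - p' * q)\<bar>"
    using assms by (simp add: abs_mult abs_divide)
  also have "\<dots> \<ge> 1" using assms(3) by linarith
  finally show ?thesis .
qed

lemma ex_common_centre:
  fixes A :: "('a \<times> real) set"
  assumes "\<And>w \<alpha> w' \<alpha>'. (w, \<alpha>) \<in> A \<Longrightarrow> (w', \<alpha>') \<in> A \<Longrightarrow> f w = f w'"
    and "\<And>w \<alpha>. (w, \<alpha>) \<in> A \<Longrightarrow> \<bar>\<alpha> - f w\<bar> < d"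
  shows "\<exists>u. \<forall>(w, \<alpha>)\<in>A. \<bar>\<alpha> - u\<bar> < (d::real)"
proof (cases "A = {}")
  case False
  then obtain w \<alpha> where "(w, \<alpha>) \<in> A" by auto
  then show ?thesis using assms by (intro exI[of _ "f w"]) fastforce
qed simp

text \<open>The one-dimensional simplex lemma: two witnessing fractions are less than
  \<open>2 * l\<^sup>2\<close> apart, while \<open>a = 1 / (2 * r)\<close> bounds their denominators
  by \<open>1 / (2 * l)\<close>, so distinct ones would differ by at least
  \<open>4 * l\<^sup>2\<close>.\<close>

lemma lattice_bad_centre:
  assumes l: "0 < l" and r: "2 \<le> r" and a: "a = 1 / (2 * r)"
    and av: "\<And>\<alpha>. \<alpha> \<in> {x..x + l\<^sup>2} \<Longrightarrow> lattice_avoids a l \<alpha>"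
  shows "\<exists>u. \<forall>\<alpha>\<in>{x..x + l\<^sup>2}. \<not> lattice_avoids a (l / r) \<alpha> \<longrightarrow> \<bar>\<alpha> - u\<bar> < l\<^sup>2 / r"
proof -
  define A where "A = {((p, q), \<alpha>). \<alpha> \<in> {x..x + l\<^sup>2} \<and> q \<noteq> 0 \<and> \<bar>of_int q\<bar> * (l / r) \<le> a \<and>
      \<bar>of_int q * \<alpha> - of_int p\<bar> \<le> a * (l / r)}"
  have a0: "0 < a" using a r by simp
  have close: "\<bar>\<alpha> - of_int p / of_int q\<bar> < l\<^sup>2 / r" if "((p, q), \<alpha>) \<in> A" for p q \<alpha>
    using that r by (intro lattice_bad_close[OF l _ a0 av]) (auto simp: A_def)
  have "\<exists>u. \<forall>(w, \<alpha>)\<in>A. \<bar>\<alpha> - u\<bar> < l\<^sup>2 / r"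
  proof (rule ex_common_centre[where f = "\<lambda>(p, q). of_int p / of_int q"])
    fix w \<alpha> w' \<alpha>' assume w: "(w, \<alpha>) \<in> A" "(w', \<alpha>') \<in> A"
    obtain p q p' q' where [simp]: "w = (p, q)" "w' = (p', q')" by (cases w, cases w')
    have q: "q \<noteq> 0" "q' \<noteq> 0" "\<bar>of_int q\<bar> * (l / r) \<le> a" "\<bar>of_int q'\<bar> * (l / r) \<le> a"
      using w by (auto simp: A_def)
    have "p * q' = p' * q"
    proof (rule ccontr)
      assume ne: "p * q' \<noteq> p' * q"
      have "\<bar>\<alpha> - \<alpha>'\<bar> \<le> l\<^sup>2" using w by (auto simp: A_def)
      moreover have "l\<^sup>2 / r \<le> l\<^sup>2 / 2" using r by (intro divide_left_mono) auto
      ultimately have d: "\<bar>of_int p / of_int q - of_int p' / of_int q'\<bar> < 2 * l\<^sup>2"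
        using close[of p q \<alpha>] close[of p' q' \<alpha>'] w by (simp add: abs_if split: if_splits)
      have "\<bar>of_int q\<bar> * l \<le> 1/2" "\<bar>of_int q'\<bar> * l \<le> 1/2" using q r by (simp_all add: a field_simps)
      then have "(\<bar>of_int q\<bar> * l) * (\<bar>of_int q'\<bar> * l) \<le> 1/2 * (1/2)" using l by (intro mult_mono) auto
      then have "\<bar>of_int q\<bar> * \<bar>of_int q'\<bar> * (2 * l\<^sup>2) \<le> 1 / 2" by (simp add: power2_eq_square mult_ac)
      moreover have "\<bar>of_int q\<bar> * \<bar>of_int q'\<bar> * \<bar>of_int p / of_int q - of_int p' / of_int q'\<bar>
          \<le> \<bar>of_int q\<bar> * \<bar>of_int q'\<bar> * (2 * l\<^sup>2)"
        using d by (intro mult_left_mono) auto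
      ultimately show False using int_fraction_diff[OF q(1,2) ne] by linarith
    qed
    then have "real_of_int p * of_int q' = of_int p' * of_int q" unfolding of_int_mult[symmetric] by simp
    then show "(\<lambda>(p, q). of_int p / of_int q) w = ((\<lambda>(p, q). of_int p / of_int q) w' :: real)"
      using q(1,2) by (simp add: frac_eq_eq)
  qed (use close in auto)
  then obtain u where u: "\<And>w \<alpha>. (w, \<alpha>) \<in> A \<Longrightarrow> \<bar>\<alpha> - u\<bar> < l\<^sup>2 / r" by blast
  have "\<bar>\<alpha> - u\<bar> < l\<^sup>2 / r" if \<alpha>: "\<alpha> \<in> {x..x + l\<^sup>2}" "\<not> lattice_avoids a (l / r) \<alpha>" for \<alpha>
  proof -
    obtain p q where "((p, q), \<alpha>) \<in> A"
      using \<alpha> unfolding lattice_avoids_def A_def by (auto simp: not_less)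
    then show ?thesis by (rule u)
  qed
  then show ?thesis by blast
qed

text \<open>
  The difference of two solutions of the inhomogeneous inequality is an approximately short lattice
  vector, hence 0; this is why \<open>a = 3 b r\<close>.
\<close>

lemma grid_bad_centre:
  assumes l: "0 < l" "l \<le> 1" and r: "2 \<le> r" and a: "a = 1 / (2 * r)" and b: "b = 1 / (6 * r\<^sup>2)"
    and av: "\<And>\<alpha>. \<alpha> \<in> {x..x + l\<^sup>2} \<Longrightarrow> lattice_avoids a l \<alpha>"
    and gr: "\<And>\<alpha>. \<alpha> \<in> {x..x + l\<^sup>2} \<Longrightarrow> grid_avoids \<gamma> b l \<alpha>"
  shows "\<exists>u. \<forall>\<alpha>\<in>{x..x + l\<^sup>2}. \<not> grid_avoids \<gamma> b (l / r) \<alpha> \<longrightarrow> \<bar>\<alpha> - u\<bar> < l\<^sup>2 / r"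
proof -
  define A where "A = {((p, q), \<alpha>). \<alpha> \<in> {x..x + l\<^sup>2} \<and> \<bar>of_int q\<bar> * (l / r) \<le> b \<and>
      \<bar>of_int q * \<alpha> - of_int p - \<gamma>\<bar> \<le> b * (l / r)}"
  have a0: "0 < a" and b0: "0 < b" using a b r by simp_all
  have ab: "a = 3 * b * r" using r by (simp add: a b power2_eq_square)
  have close: "\<bar>\<alpha> - (of_int p + \<gamma>) / of_int q\<bar> < l\<^sup>2 / r" if "((p, q), \<alpha>) \<in> A" for p q \<alpha>
    using that r by (intro grid_bad_close[OF l(1) _ b0 gr]) (auto simp: A_def)
  have "\<exists>u. \<forall>(w, \<alpha>)\<in>A. \<bar>\<alpha> - u\<bar> < l\<^sup>2 / r"
  proof (rule ex_common_centre[where f = "\<lambda>(p, q). (of_int p + \<gamma>) / of_int q"])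
    fix w \<alpha> w' \<alpha>' assume w: "(w, \<alpha>) \<in> A" "(w', \<alpha>') \<in> A"
    obtain p q p' q' where [simp]: "w = (p, q)" "w' = (p', q')" by (cases w, cases w')
    have q: "\<bar>of_int q\<bar> * l \<le> b * r" "\<bar>of_int q'\<bar> * l \<le> b * r"
      and e: "\<bar>of_int q * \<alpha> - of_int p - \<gamma>\<bar> \<le> b * (l / r)" "\<bar>of_int q' * \<alpha>' - of_int p' - \<gamma>\<bar> \<le> b * (l / r)"
      and \<alpha>: "\<alpha> \<in> {x..x + l\<^sup>2}"
      using w r by (auto simp: A_def field_simps)
    \<comment> \<open>The two inequalities hold at different points. Moving the second one to
      \<alpha> costs at most \<open>b * r * l\<close>, and each of the two errors is at most that as
      well; hence the factor 3 in \<open>a = 3 * b * r\<close>.\<close>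
    have "\<bar>\<alpha> - \<alpha>'\<bar> \<le> l\<^sup>2" using w by (auto simp: A_def)
    then have "\<bar>of_int q' * (\<alpha> - \<alpha>')\<bar> \<le> \<bar>of_int q'\<bar> * l\<^sup>2" by (simp add: abs_mult mult_left_mono)
    also have "\<dots> \<le> b * r * l" using mult_right_mono[OF q(2), of l] l by (simp add: power2_eq_square mult_ac)
    finally have e3: "\<bar>of_int q' * (\<alpha> - \<alpha>')\<bar> \<le> b * r * l" .
    have "b * (l / r) \<le> b * r * l"
    proof -
      have "1 / r \<le> 1" using r by simp
      then have "1 / r \<le> r" using r by linarith
      then have "b * l * (1 / r) \<le> b * l * r" using b0 l by (intro mult_left_mono) auto
      then show ?thesis by (simp add: mult_ac)
    qed
    then have small: "\<bar>of_int (q - q') * \<alpha> - of_int (p - p')\<bar> \<le> a * l"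
      using e e3 unfolding ab by (simp add: algebra_simps abs_if split: if_splits)
    have "\<bar>of_int (q - q')\<bar> * l \<le> (\<bar>of_int q\<bar> + \<bar>of_int q'\<bar>) * l" using l by (intro mult_right_mono) auto
    also have "\<dots> \<le> a"
    proof -
      have "0 \<le> b * r" using b0 r by simp
      then show ?thesis using q unfolding ab distrib_right by linarith
    qed
    finally have "\<not> q - q' \<noteq> 0"
      using av[OF \<alpha>] small unfolding lattice_avoids_def by (metis not_less of_int_abs)
    then have "q = q'" by simp
    moreover from this have "p = p'"
    proof -
      have "a * l \<le> a" using l a0 by simp
      also have "a < 1" using r by (simp add: a)
      finally have "\<bar>of_int (p - p') :: real\<bar> < 1" using small \<open>q = q'\<close> by simp
      then show ?thesis by linarith
    qed
    ultimately show "(case w of (p, q) \<Rightarrow> (of_int p + \<gamma>) / of_int q) = (case w' of (p, q) \<Rightarrow> (of_int p + \<gamma>) / of_int q)"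
      by simp
  qed (use close in auto)
  then obtain u where u: "\<And>w \<alpha>. (w, \<alpha>) \<in> A \<Longrightarrow> \<bar>\<alpha> - u\<bar> < l\<^sup>2 / r" by blast
  have "\<bar>\<alpha> - u\<bar> < l\<^sup>2 / r" if \<alpha>: "\<alpha> \<in> {x..x + l\<^sup>2}" "\<not> grid_avoids \<gamma> b (l / r) \<alpha>" for \<alpha>
  proof -
    obtain p q where "((p, q), \<alpha>) \<in> A"
      using \<alpha> unfolding grid_avoids_def A_def by (auto simp: not_less)
    then show ?thesis by (rule u)
  qed
  then show ?thesis by blast
qed

definition good_interval :: "real \<Rightarrow> real \<Rightarrow> real \<Rightarrow> real \<Rightarrow> real \<Rightarrow> bool" where
  "good_interval \<gamma> a b l x \<longleftrightarrow> (\<forall>\<alpha>\<in>{x..x + l\<^sup>2}. lattice_avoids a l \<alpha> \<and> grid_avoids \<gamma> b l \<alpha>)"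

lemma good_interval_split:
  fixes r :: nat
  assumes l: "0 < l" "l \<le> 1" and r: "2 \<le> r" and a: "a = 1 / (2 * real r)" and b: "b = 1 / (6 * (real r)\<^sup>2)"
    and good: "good_interval \<gamma> a b l x"
  shows "\<exists>C. finite C \<and> card C = r\<^sup>2 - (4 * r + 4) \<and>
    (\<forall>y\<in>C. good_interval \<gamma> a b (l / r) y \<and> x \<le> y \<and> y + (l / r)\<^sup>2 \<le> x + l\<^sup>2) \<and>
    (\<forall>y\<in>C. \<forall>z\<in>C. y \<noteq> z \<longrightarrow> (l / r)\<^sup>2 \<le> \<bar>y - z\<bar>)"
proof -
  define h where "h = (l / r)\<^sup>2"
  have h: "0 < h" using l r by (simp add: h_def)
  have lh: "l\<^sup>2 = (real r)\<^sup>2 * h" using r by (simp add: h_def power_divide)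
  have lr: "l\<^sup>2 / r = r * h" using r by (simp add: h_def power2_eq_square)
  define y where "y i = x + real i * h" for i :: nat
  have sep: "h \<le> \<bar>y i - y j\<bar>" if "i \<noteq> j" for i j
  proof -
    have "1 \<le> \<bar>real i - real j\<bar>" using that by linarith
    then have "1 * h \<le> \<bar>real i - real j\<bar> * h" using h by (intro mult_right_mono) auto
    also have "\<dots> = \<bar>(real i - real j) * h\<bar>" using h by (simp add: abs_mult)
    also have "(real i - real j) * h = y i - y j" by (simp add: y_def left_diff_distrib)
    finally show ?thesis by simp
  qed
  have inj: "inj y" using h by (auto simp: inj_def y_def)
  define S where "S = y ` {..<r\<^sup>2}"
  have S: "finite S" "card S = r\<^sup>2" using card_image[OF inj_on_subset[OF inj]] by (auto simp: S_def)
  have S_sep: "h \<le> \<bar>u - v\<bar>" if "u \<in> S" "v \<in> S" "u \<noteq> v" for u v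
    using that sep unfolding S_def by (metis imageE)
  have S_sub: "x \<le> u \<and> u + h \<le> x + l\<^sup>2" if "u \<in> S" for u
  proof -
    obtain i where i: "u = y i" "i < r\<^sup>2" using \<open>u \<in> S\<close> by (auto simp: S_def)
    then have "real (Suc i) \<le> real (r\<^sup>2)" by (simp only: of_nat_le_iff)
    then have "real (Suc i) * h \<le> (real r)\<^sup>2 * h" using h by (intro mult_right_mono) auto
    then show ?thesis using h i by (simp add: y_def lh algebra_simps)
  qed
  have X: "lattice_avoids a l \<alpha>" "grid_avoids \<gamma> b l \<alpha>" if "\<alpha> \<in> {x..x + l\<^sup>2}" for \<alpha>
    using good that by (auto simp: good_interval_def)
  have r2: "2 \<le> real r" using r by simp
  obtain u where u: "\<And>\<alpha>. \<alpha> \<in> {x..x + l\<^sup>2} \<Longrightarrow> \<not> lattice_avoids a (l / r) \<alpha> \<Longrightarrow> \<bar>\<alpha> - u\<bar> < l\<^sup>2 / r"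
    using lattice_bad_centre[OF l(1) r2 a X(1)] by blast
  obtain v where v: "\<And>\<alpha>. \<alpha> \<in> {x..x + l\<^sup>2} \<Longrightarrow> \<not> grid_avoids \<gamma> b (l / r) \<alpha> \<Longrightarrow> \<bar>\<alpha> - v\<bar> < l\<^sup>2 / r"
    using grid_bad_centre[OF l r2 a b X] by blast
  \<comment> \<open>A piece that meets the ball of radius \<open>r * h\<close> has its left endpoint
    within \<open>(r + 1) * h\<close> of the centre, which leaves \<open>2 * r + 2\<close>
    candidates per centre.\<close>
  define B where "B u = {t \<in> S. \<exists>\<alpha>\<in>{t..t + h}. \<bar>\<alpha> - u\<bar> < l\<^sup>2 / r}" for u
  have B: "card (B u) \<le> 2 * r + 2" for u
  proof (rule card_separated_le[OF _ h])
    show "B u \<subseteq> {u - (r + 1) * h<..<u - (r + 1) * h + real (2 * r + 2) * h}"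
      using h unfolding lr B_def by (auto simp: algebra_simps abs_less_iff)
  qed (use S S_sep in \<open>auto simp: B_def\<close>)
  define G where "G = S - (B u \<union> B v)"
  have "card (B u \<union> B v) \<le> 4 * r + 4"
    using card_Un_le[of "B u" "B v"] B[of u] B[of v] by simp
  moreover have "card G \<ge> card S - card (B u \<union> B v)"
    unfolding G_def by (rule diff_card_le_card_Diff) (use S in \<open>auto simp: B_def\<close>)
  ultimately have "r\<^sup>2 - (4 * r + 4) \<le> card G" using S by linarith
  \<comment> \<open>Surplus good pieces are discarded, as all nodes of a level must have equally
    many children.\<close>
  then obtain C where C: "C \<subseteq> G" "card C = r\<^sup>2 - (4 * r + 4)" "finite C"
    by (rule obtain_subset_with_card_n)
  have "good_interval \<gamma> a b (l / r) t" if "t \<in> C" for t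
    unfolding good_interval_def
  proof
    fix \<alpha> assume \<alpha>: "\<alpha> \<in> {t..t + (l / real r)\<^sup>2}"
    have t: "t \<in> S" "t \<notin> B u" "t \<notin> B v" using that C by (auto simp: G_def)
    then have "\<alpha> \<in> {x..x + l\<^sup>2}" using S_sub \<alpha> by (fastforce simp: h_def)
    then show "lattice_avoids a (l / r) \<alpha> \<and> grid_avoids \<gamma> b (l / r) \<alpha>"
      using t \<alpha> u[of \<alpha>] v[of \<alpha>] unfolding B_def h_def by blast
  qed
  moreover have "C \<subseteq> S" using C by (auto simp: G_def)
  ultimately show ?thesis using C S_sub S_sep unfolding h_def by (intro exI[of _ C]) blast
qed

section \<open>Special steps\<close>

text \<open>The integer near \<open>u + s * v\<close> must advance by exactly \<open>m\<close> in
  each step, because any two candidates differ by less than 1. The drift \<open>s * (v - m)\<close>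
  thus accumulates without wrapping around, and its total stays below 1/2.\<close>

lemma near_int_progression:
  fixes u v :: real and m :: int and T :: nat
  assumes near: "\<And>s. s \<le> T \<Longrightarrow> \<exists>n::int. \<bar>u + real s * v - of_int n\<bar> < 1/4"
    and m: "\<bar>v - of_int m\<bar> < 1/4"
  shows "real T * \<bar>v - of_int m\<bar> \<le> 1/2"
proof -
  obtain n0 :: int where n0: "\<bar>u - of_int n0\<bar> < 1/4" using near[of 0] by auto
  have "\<bar>u + real s * v - of_int (n0 + int s * m)\<bar> < 1/4" if "s \<le> T" for s
    using that
  proof (induction s)
    case (Suc s)
    obtain n :: int where n: "\<bar>u + real (Suc s) * v - of_int n\<bar> < 1/4" using near[OF Suc.prems] by auto
    let ?t = "n0 + int (Suc s) * m"
    have eq: "u + real (Suc s) * v - of_int ?t = (u + real s * v - of_int (n0 + int s * m)) + (v - of_int m)"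
      by (simp add: algebra_simps)
    have IH: "\<bar>u + real s * v - of_int (n0 + int s * m)\<bar> < 1/4" using Suc by simp
    have "\<bar>u + real (Suc s) * v - of_int ?t\<bar> < 1/2" unfolding eq using IH m by linarith
    with n have "\<bar>real_of_int n - of_int ?t\<bar> < 1" by linarith
    then have "n = ?t" by linarith
    with n show ?case by simp
  qed (use n0 in simp)
  then have "\<bar>u + real T * v - of_int (n0 + int T * m)\<bar> < 1/4" by simp
  moreover have "u + real T * v - of_int (n0 + int T * m) = (u - of_int n0) + real T * (v - of_int m)"
    by (simp add: algebra_simps)
  ultimately have "\<bar>real T * (v - of_int m)\<bar> < 1/2" using n0 by linarith
  then show ?thesis by (simp add: abs_mult)
qed

text \<open>The first fraction comes from Dirichlet's theorem, the second from Bezout's identity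
  after adding a large multiple of the first: they differ by \<open>1 / (q1 * q2)\<close>, which is
  at most \<open>l\<^sup>2 / 8\<close> once \<open>q2\<close> exceeds \<open>q1\<close> by a factor
  of order \<open>1 / a\<^sup>2\<close>. Unimodularity will make the later combinations
  coprime.\<close>

lemma ex_unimodular_pair:
  fixes l a z :: real
  assumes l: "0 < l" "l \<le> 1" and a: "0 < a" "a \<le> 1" and av: "\<And>\<alpha>. \<bar>\<alpha> - z\<bar> \<le> l\<^sup>2 / 4 \<Longrightarrow> lattice_avoids a l \<alpha>"
  obtains p1 q1 p2 q2 :: int where "q2 * p1 - p2 * q1 = 1" "0 < q1" "0 < q2"
    "\<bar>of_int p1 - of_int q1 * z\<bar> \<le> of_int q1 * (l\<^sup>2 / 4)" "\<bar>of_int p2 - of_int q2 * z\<bar> \<le> of_int q2 * (l\<^sup>2 / 4)"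
    "of_int q1 * l \<le> 9 / a * (8 / a\<^sup>2 + 2)" "of_int q2 * l \<le> 9 / a * (8 / a\<^sup>2 + 2)"
proof -
  \<comment> \<open>With \<open>1 / N \<le> a * l / 8\<close>, lattice avoidance at \<open>z\<close>
    forces \<open>a < q1 * l\<close>, and the Dirichlet error then drops below
    \<open>q1 * l\<^sup>2 / 8\<close>.\<close>
  define N where "N = nat \<lceil>8 / (a * l)\<rceil>"
  have al: "0 < a * l" "a * l \<le> 1" using l a by (auto simp: mult_le_one)
  then have N8: "8 / (a * l) \<le> real N" unfolding N_def by linarith
  have N0: "0 < real N" using N8 al by (smt (verit) divide_pos_pos)
  have "real N \<le> 8 / (a * l) + 1" using al unfolding N_def by simp
  also have "1 \<le> 1 / (a * l)" using al by simp
  finally have N9: "real N \<le> 9 / (a * l)" by simp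
  obtain p1 q1 :: int where p1: "coprime p1 q1" "0 < q1" "q1 \<le> int N" "\<bar>of_int q1 * z - of_int p1\<bar> < 1 / N"
    using Dirichlet_approx_coprime[of N z] N0 by auto
  have invN: "1 / N \<le> a * l / 8"
  proof -
    have "8 \<le> real N * (a * l)" using N8 al by (simp add: pos_divide_le_eq)
    then show ?thesis using N0 by (simp add: pos_divide_le_eq mult_ac)
  qed
  have "\<bar>of_int q1 * z - of_int p1\<bar> \<le> a * l" using p1(4) invN al by linarith
  then have aq1: "a < of_int q1 * l"
    using av[of z] p1(2) unfolding lattice_avoids_def by (force simp: not_le[symmetric])
  have "a * l / 8 \<le> of_int q1 * (l\<^sup>2 / 8)"
    using mult_right_mono[OF less_imp_le[OF aq1], of "l / 8"] l by (simp add: power2_eq_square mult_ac)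
  then have c1: "\<bar>of_int p1 - of_int q1 * z\<bar> \<le> of_int q1 * (l\<^sup>2 / 8)" using p1(4) invN by linarith
  have q1l: "of_int q1 * l \<le> 9 / a"
  proof -
    have "of_int q1 \<le> real N" using p1(3) by linarith
    then have "of_int q1 * l \<le> 9 / (a * l) * l" using N9 l by (intro mult_right_mono) auto
    then show ?thesis using l by simp
  qed
  obtain u v :: int where uv: "u * p1 + v * q1 = 1" using bezout_int[of p1 q1] p1(1) by (auto simp: coprime_iff_gcd_eq_1)
  define T where "T = \<lceil>8 / a\<^sup>2\<rceil>"
  have T: "8 / a\<^sup>2 \<le> of_int T" "of_int T \<le> 8 / a\<^sup>2 + 1" unfolding T_def by linarith+
  have T0: "0 < (of_int T :: real)" using T(1) a by (smt (verit) divide_pos_pos zero_less_power)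
  \<comment> \<open>This shift makes \<open>q2 = T * q1 + u mod q1\<close>, so the ratio of the
    denominators lies between \<open>T\<close> and \<open>T + 1\<close>.\<close>
  define t where "t = T - u div q1"
  define q2 where "q2 = u + t * q1"
  define p2 where "p2 = t * p1 - v"
  have det: "q2 * p1 - p2 * q1 = 1" using uv by (simp add: q2_def p2_def algebra_simps)
  have q2: "q2 = T * q1 + u mod q1" by (simp add: q2_def t_def algebra_simps minus_div_mult_eq_mod[symmetric])
  have um: "0 \<le> u mod q1" "u mod q1 < q1" using p1(2) by simp_all
  have T0': "0 < T" using T0 by simp
  then have "0 < T * q1" using p1(2) by simp
  then have q2_pos: "0 < q2" using um q2 by linarith
  have "T * q1 \<le> q2" using um q2 by linarith
  then have q2_ge: "of_int T * of_int q1 \<le> (of_int q2 :: real)" by (metis of_int_le_iff of_int_mult)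
  have "q2 \<le> (T + 1) * q1" using um q2 by (simp add: algebra_simps)
  then have q2_le: "of_int q2 \<le> (of_int T + 1) * (of_int q1 :: real)" by (metis of_int_le_iff of_int_mult of_int_add of_int_1)
  have "of_int q2 * l \<le> (of_int T + 1) * (of_int q1 * l)"
    using mult_right_mono[OF q2_le, of l] l by (simp add: mult_ac)
  also have "\<dots> \<le> (8 / a\<^sup>2 + 2) * (9 / a)"
    using T q1l T0 l p1(2) a by (intro mult_mono) auto
  finally have q2l: "of_int q2 * l \<le> 9 / a * (8 / a\<^sup>2 + 2)" by (simp add: mult_ac)
  have "9 / a * 1 \<le> 9 / a * (8 / a\<^sup>2 + 2)" using a by (intro mult_left_mono) (auto simp: add_nonneg_pos)
  then have q1l': "of_int q1 * l \<le> 9 / a * (8 / a\<^sup>2 + 2)" using q1l by simp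
  have "q1 * p2 = p1 * q2 - 1" using det by (simp add: algebra_simps)
  then have "real_of_int q1 * of_int p2 = of_int p1 * of_int q2 - 1" by (metis of_int_mult of_int_diff of_int_1)
  then have e: "of_int q1 * (of_int p2 - of_int q2 * z) = of_int q2 * (of_int p1 - of_int q1 * z) - (1::real)"
    by (simp add: algebra_simps)
  have one: "1 \<le> of_int q1 * (of_int q2 * (l\<^sup>2 / 8))"
  proof -
    have "8 \<le> of_int T * a\<^sup>2" using T(1) a by (simp add: pos_divide_le_eq)
    also have "\<dots> \<le> of_int T * (of_int q1 * l)\<^sup>2" using T0 aq1 a by (intro mult_left_mono power_mono) auto
    also have "\<dots> = (of_int T * of_int q1) * (of_int q1 * l\<^sup>2)" by (simp add: power2_eq_square mult_ac)
    also have "\<dots> \<le> of_int q2 * (of_int q1 * l\<^sup>2)" using q2_ge p1(2) by (intro mult_right_mono) auto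
    finally show ?thesis by (simp add: mult_ac)
  qed
  have "\<bar>of_int q2 * (of_int p1 - of_int q1 * z)\<bar> \<le> of_int q2 * (of_int q1 * (l\<^sup>2 / 8))"
    using c1 q2_pos by (simp add: abs_mult)
  also have "\<dots> = of_int q1 * (of_int q2 * (l\<^sup>2 / 8))" by (rule mult.left_commute)
  finally have "\<bar>of_int q2 * (of_int p1 - of_int q1 * z) - 1\<bar> \<le> 2 * (of_int q1 * (of_int q2 * (l\<^sup>2 / 8)))"
    using one by linarith
  also have "\<dots> = of_int q1 * (of_int q2 * (l\<^sup>2 / 4))" by simp
  finally have "\<bar>of_int q1 * (of_int p2 - of_int q2 * z)\<bar> \<le> of_int q1 * (of_int q2 * (l\<^sup>2 / 4))"
    unfolding e .
  then have c2: "\<bar>of_int p2 - of_int q2 * z\<bar> \<le> of_int q2 * (l\<^sup>2 / 4)"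
    using p1(2) by (simp add: abs_mult)
  have c1': "\<bar>of_int p1 - of_int q1 * z\<bar> \<le> of_int q1 * (l\<^sup>2 / 4)"
  proof -
    have "of_int q1 * (l\<^sup>2 / 8) \<le> of_int q1 * (l\<^sup>2 / 4)" using p1(2) by (intro mult_left_mono) auto
    then show ?thesis using c1 by linarith
  qed
  show thesis using that[OF det p1(2) q2_pos c1' c2 q1l' q2l] .
qed

text \<open>
  If all \<open>q\<^sub>1 + s q\<^sub>2\<close> and \<open>s q\<^sub>1 + q\<^sub>2\<close> with \<open>s \<le> T\<close> have \<open>q \<gamma>\<close> near an integer, then \<open>q\<^sub>i \<gamma> = n\<^sub>i + e\<^sub>i\<close> with
  tiny \<open>e\<^sub>i\<close>. Solving \<open>q p\<^sub>i - p q\<^sub>i = n\<^sub>i\<close> for \<open>i = 1, 2\<close> (the determinant is a unit) gives a pair \<open>(p, q)\<close> that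
  contradicts grid avoidance at \<open>p\<^sub>1 / q\<^sub>1\<close>.
\<close>

lemma ex_far_denominator:
  fixes a b \<gamma> :: real
  assumes a: "0 < a" "a \<le> 1" and b: "0 < b"
  obtains C :: real where "0 < C"
    "\<And>l x. 0 < l \<Longrightarrow> l \<le> 1 \<Longrightarrow> good_interval \<gamma> a b l x \<Longrightarrow>
      \<exists>p q :: int. coprime p q \<and> 0 < q \<and> a < of_int q * l \<and> of_int q * l \<le> C \<and>
        \<bar>of_int p / of_int q - (x + l\<^sup>2 / 2)\<bar> \<le> l\<^sup>2 / 4 \<and> (\<forall>n::int. 1/4 \<le> \<bar>of_int q * \<gamma> - of_int n\<bar>)"
proof -
  define C0 where "C0 = 9 / a * (8 / a\<^sup>2 + 2)"
  have C0: "0 < C0" using a by (simp add: C0_def add_pos_pos)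
  \<comment> \<open>Beating \<open>C0 / b\<close> puts the denominator \<open>q0\<close> below into
    the range of \<open>grid_avoids\<close>; beating \<open>1 / (a * b)\<close> makes the error
    \<open>e1\<close>, at most \<open>1 / (2 * T)\<close>, smaller than the bound
    \<open>a * b\<close> that grid avoidance yields.\<close>
  obtain T :: nat where T: "max (C0 / b) (1 / (a * b)) < real T" using reals_Archimedean2 by blast
  then have Tb: "C0 \<le> real T * b" "1 \<le> real T * (a * b)" using a b by (auto simp: pos_divide_less_eq)
  have T0: "0 < real T" using Tb(1) C0 b by (metis less_le_trans zero_less_mult_pos2)
  define C where "C = (real T + 1) * C0"
  have "\<exists>p q :: int. coprime p q \<and> 0 < q \<and> a < of_int q * l \<and> of_int q * l \<le> C \<and>
        \<bar>of_int p / of_int q - (x + l\<^sup>2 / 2)\<bar> \<le> l\<^sup>2 / 4 \<and> (\<forall>n::int. 1/4 \<le> \<bar>of_int q * \<gamma> - of_int n\<bar>)"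
    if l: "0 < l" "l \<le> 1" and good: "good_interval \<gamma> a b l x" for l x
  proof -
    define z where "z = x + l\<^sup>2 / 2"
    have av: "lattice_avoids a l \<alpha>" and gr: "grid_avoids \<gamma> b l \<alpha>" if "\<bar>\<alpha> - z\<bar> \<le> l\<^sup>2 / 4" for \<alpha>
    proof -
      have "\<alpha> \<in> {x..x + l\<^sup>2}"
        using that zero_le_power2[of l] unfolding z_def abs_le_iff atLeastAtMost_iff by linarith
      then show "lattice_avoids a l \<alpha>" "grid_avoids \<gamma> b l \<alpha>" using good by (auto simp: good_interval_def)
    qed
    obtain p1 q1 p2 q2 :: int where det: "q2 * p1 - p2 * q1 = 1" and q: "0 < q1" "0 < q2"
      and c: "\<bar>of_int p1 - of_int q1 * z\<bar> \<le> of_int q1 * (l\<^sup>2 / 4)" "\<bar>of_int p2 - of_int q2 * z\<bar> \<le> of_int q2 * (l\<^sup>2 / 4)"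
      and ql: "of_int q1 * l \<le> C0" "of_int q2 * l \<le> C0"
      by (rule ex_unimodular_pair[OF l a av, folded C0_def])
    have close: "\<bar>of_int p / of_int q - z\<bar> \<le> l\<^sup>2 / 4" if "0 < q" "\<bar>of_int p - of_int q * z\<bar> \<le> of_int q * (l\<^sup>2 / 4)" for p q :: int
    proof -
      have "of_int q * \<bar>of_int p / of_int q - z\<bar> = \<bar>of_int q * (of_int p / of_int q - z)\<bar>"
        using that(1) by (simp add: abs_mult)
      also have "of_int q * (of_int p / of_int q - z) = of_int p - of_int q * z"
        using that(1) by (simp add: right_diff_distrib)
      finally have "of_int q * \<bar>of_int p / of_int q - z\<bar> \<le> of_int q * (l\<^sup>2 / 4)" using that(2) by simp
      then show ?thesis using that(1) by simp
    qed
    have lower: "a < of_int q * l" if "0 < q" "\<bar>of_int p / of_int q - z\<bar> \<le> l\<^sup>2 / 4" for p q :: int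
    proof (rule ccontr)
      assume "\<not> ?thesis"
      then have "a * l < \<bar>of_int q * (of_int p / of_int q) - of_int p\<bar>"
        using av[OF that(2), unfolded lattice_avoids_def, rule_format, of q p] that(1) by simp
      then show False using that(1) a l by (simp add: mult_less_0_iff)
    qed
    \<comment> \<open>Closeness to \<open>z\<close> is multiplied by the denominator so that it
      passes to nonnegative combinations, that is, to mediants.\<close>
    define good_pt where "good_pt p q \<longleftrightarrow> coprime p q \<and> 0 < q \<and> \<bar>of_int p - of_int q * z\<bar> \<le> of_int q * (l\<^sup>2 / 4) \<and> of_int q * l \<le> C" for p q :: int
    have comb: "good_pt (p1 + int s * p2) (q1 + int s * q2)" "good_pt (p2 + int s * p1) (q2 + int s * q1)" if "s \<le> T" for s
    proof -
      have sum: "\<bar>of_int (p + int s * p') - of_int (q + int s * q') * z\<bar> \<le> of_int (q + int s * q') * (l\<^sup>2 / 4)"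
        if "\<bar>of_int p - of_int q * z\<bar> \<le> of_int q * (l\<^sup>2 / 4)" "\<bar>of_int p' - of_int q' * z\<bar> \<le> of_int q' * (l\<^sup>2 / 4)" for p q p' q' :: int
      proof -
        have "of_int (p + int s * p') - of_int (q + int s * q') * z = (of_int p - of_int q * z) + real s * (of_int p' - of_int q' * z)"
          by (simp add: algebra_simps)
        also have "\<bar>\<dots>\<bar> \<le> \<bar>of_int p - of_int q * z\<bar> + real s * \<bar>of_int p' - of_int q' * z\<bar>"
          by (metis abs_triangle_ineq abs_mult abs_of_nat)
        also have "\<dots> \<le> of_int q * (l\<^sup>2 / 4) + real s * (of_int q' * (l\<^sup>2 / 4))"
          using that by (intro add_mono mult_left_mono) auto
        finally show ?thesis by (simp add: algebra_simps)
      qed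
      have size: "of_int (q + int s * q') * l \<le> C" if "of_int q * l \<le> C0" "of_int q' * l \<le> C0" "0 < q'" for q q' :: int
      proof -
        have "real s * (of_int q' * l) \<le> real T * C0" using that \<open>s \<le> T\<close> l by (intro mult_mono) auto
        then show ?thesis using that(1) by (simp add: C_def algebra_simps)
      qed
      have cop: "coprime p q" if "u * p + v * q = 1" for p q u v :: int
        using that by (metis coprimeI dvd_add dvd_mult)
      have "coprime (p1 + int s * p2) (q1 + int s * q2)"
        by (rule cop[where u = q2 and v = "- p2"]) (use det in \<open>simp add: algebra_simps\<close>)
      moreover have "coprime (p2 + int s * p1) (q2 + int s * q1)"
        by (rule cop[where u = "- q1" and v = "p1"]) (use det in \<open>simp add: algebra_simps\<close>)
      moreover have "0 < q1 + int s * q2" "0 < q2 + int s * q1" using q by (simp_all add: add_pos_nonneg)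
      ultimately show "good_pt (p1 + int s * p2) (q1 + int s * q2)" "good_pt (p2 + int s * p1) (q2 + int s * q1)"
        unfolding good_pt_def using sum c size ql q by blast+
    qed
    have "\<exists>p q. good_pt p q \<and> (\<forall>n::int. 1/4 \<le> \<bar>of_int q * \<gamma> - of_int n\<bar>)"
    proof (rule ccontr)
      assume "\<not> ?thesis"
      then have near: "\<exists>n::int. \<bar>of_int q * \<gamma> - of_int n\<bar> < 1/4" if "good_pt p q" for p q
        using that by (meson not_le)
      obtain n1 n2 :: int where n: "\<bar>of_int q1 * \<gamma> - of_int n1\<bar> < 1/4" "\<bar>of_int q2 * \<gamma> - of_int n2\<bar> < 1/4"
        using near[OF comb(1)[of 0]] near[OF comb(2)[of 0]] by auto
      define e1 where "e1 = of_int q1 * \<gamma> - of_int n1"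
      define e2 where "e2 = of_int q2 * \<gamma> - of_int n2"
      have "real T * \<bar>e2\<bar> \<le> 1/2"
        unfolding e2_def
      proof (rule near_int_progression[OF _ n(2)])
        show "\<exists>n::int. \<bar>of_int q1 * \<gamma> + real s * (of_int q2 * \<gamma>) - of_int n\<bar> < 1/4" if "s \<le> T" for s
          using near[OF comb(1)[OF that]] by (simp add: algebra_simps)
      qed
      moreover have "real T * \<bar>e1\<bar> \<le> 1/2"
        unfolding e1_def
      proof (rule near_int_progression[OF _ n(1)])
        show "\<exists>n::int. \<bar>of_int q2 * \<gamma> + real s * (of_int q1 * \<gamma>) - of_int n\<bar> < 1/4" if "s \<le> T" for s
          using near[OF comb(2)[OF that]] by (simp add: algebra_simps)
      qed
      ultimately have e: "real T * \<bar>e1\<bar> \<le> 1/2" "real T * \<bar>e2\<bar> \<le> 1/2" by blast+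
      define q0 where "q0 = n1 * q2 - n2 * q1"
      define p0 where "p0 = p2 * n1 - p1 * n2"
      \<comment> \<open>The products containing \<gamma> cancel, so \<open>q0\<close> is a
        combination of the denominators with coefficients of size at most
        \<open>1 / (2 * T)\<close>.\<close>
      have q0_eq: "real_of_int q0 = e2 * of_int q1 - e1 * of_int q2" by (simp add: q0_def e1_def e2_def algebra_simps)
      have "real T * of_int q0 = (real T * e2) * of_int q1 - (real T * e1) * of_int q2"
        unfolding q0_eq by (simp add: algebra_simps)
      also have "\<bar>\<dots>\<bar> \<le> \<bar>(real T * e2) * of_int q1\<bar> + \<bar>(real T * e1) * of_int q2\<bar>"
        by (rule abs_triangle_ineq4)
      also have "\<dots> = (real T * \<bar>e2\<bar>) * of_int q1 + (real T * \<bar>e1\<bar>) * of_int q2"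
        using q by (simp add: abs_mult)
      also have "\<dots> \<le> 1/2 * of_int q1 + 1/2 * of_int q2"
        using e q by (intro add_mono mult_right_mono) auto
      finally have "real T * \<bar>of_int q0\<bar> \<le> 1/2 * of_int q1 + 1/2 * of_int q2" by (simp add: abs_mult)
      then have "real T * \<bar>of_int q0\<bar> * l \<le> (1/2 * of_int q1 + 1/2 * of_int q2) * l"
        using l by (intro mult_right_mono) auto
      also have "\<dots> \<le> C0" using ql by (simp add: algebra_simps)
      also have "\<dots> \<le> real T * b" by (rule Tb)
      finally have q0: "\<bar>of_int q0\<bar> * l \<le> b" using T0 by (simp add: mult.assoc)
      let ?\<alpha> = "of_int p1 / of_int q1 :: real"
      have "\<bar>?\<alpha> - z\<bar> \<le> l\<^sup>2 / 4" by (rule close[OF q(1) c(1)])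
      \<comment> \<open>\<open>q0 = 0\<close> has not been excluded; this is where the case
        \<open>q = 0\<close> of \<open>grid_avoids\<close> matters.\<close>
      then have lt: "b * l < \<bar>of_int q0 * ?\<alpha> - of_int p0 - \<gamma>\<bar>" and aq: "a < of_int q1 * l"
        using gr q0 lower[OF q(1)] unfolding grid_avoids_def by blast+
      have "p1 * q0 - p0 * q1 = n1 * (q2 * p1 - p2 * q1)" by (simp add: q0_def p0_def algebra_simps)
      then have "real_of_int p1 * of_int q0 - of_int p0 * of_int q1 = of_int n1"
        using det by (metis mult.right_neutral of_int_diff of_int_mult)
      moreover have "of_int q1 * (of_int q0 * ?\<alpha>) = real_of_int p1 * of_int q0" using q(1) by simp
      ultimately have "of_int q1 * (of_int q0 * ?\<alpha> - of_int p0 - \<gamma>) = - e1"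
        unfolding e1_def right_diff_distrib by (simp add: mult.commute)
      then have "of_int q1 * \<bar>of_int q0 * ?\<alpha> - of_int p0 - \<gamma>\<bar> = \<bar>e1\<bar>"
        using q(1) by (metis abs_minus_cancel abs_mult abs_of_pos of_int_0_less_iff)
      then have "of_int q1 * (b * l) < \<bar>e1\<bar>" using lt q(1) by (metis mult_strict_left_mono of_int_0_less_iff)
      moreover have "a * b \<le> of_int q1 * (b * l)" using aq b mult_right_mono[of a "of_int q1 * l" b] by (simp add: mult_ac)
      ultimately have "real T * (a * b) \<le> real T * \<bar>e1\<bar>" using T0 by (intro mult_left_mono) auto
      then show False using Tb(2) e(1) by linarith
    qed
    then obtain p q where "good_pt p q" "\<forall>n::int. 1/4 \<le> \<bar>of_int q * \<gamma> - of_int n\<bar>" by blast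
    then show ?thesis unfolding good_pt_def z_def[symmetric] using close lower by blast
  qed
  moreover have "0 < C" using C0 T0 by (simp add: C_def)
  ultimately show thesis using that by blast
qed

text \<open>
  Multiples of \<open>(q, p)\<close> are long enough because \<open>\<alpha>\<close> keeps the distance \<open>2 a \<theta> l / q\<close> from \<open>p / q\<close>; for
  all other vectors, and for the grid, \<open>\<alpha>\<close> behaves like \<open>p / q\<close> up to the new scale \<open>\<theta> l\<close>.
\<close>

lemma special_point:
  fixes a b C l \<theta> \<gamma> \<alpha> :: real and p q :: int
  assumes l: "0 < l" and a: "0 < a" "a \<le> 1/4" and b: "0 < b" and ab: "a * b \<le> 1/32"
    and C: "0 < C" and \<theta>: "0 < \<theta>" "16 * C * b * \<theta> \<le> 1" "4 * C * a * \<theta> \<le> 1"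
    and pq: "coprime p q" "0 < q" "of_int q * l \<le> C" "\<forall>n::int. 1/4 \<le> \<bar>of_int q * \<gamma> - of_int n\<bar>"
    and \<alpha>: "2 * a * \<theta> * l \<le> of_int q * (\<alpha> - of_int p / of_int q)"
           "of_int q * (\<alpha> - of_int p / of_int q) \<le> 4 * a * \<theta> * l"
  shows "lattice_avoids a (\<theta> * l) \<alpha>" and "grid_avoids \<gamma> b (\<theta> * l) \<alpha>"
    and "\<bar>\<alpha> - of_int p / of_int q\<bar> \<le> 4 * a * C * \<theta> / (of_int q)\<^sup>2"
    and "\<bar>of_int q'\<bar> * (\<theta> * l) \<le> b \<Longrightarrow> l / (8 * C) \<le> \<bar>of_int q' * \<alpha> - of_int p' - \<gamma>\<bar>"
proof -
  define \<delta> where "\<delta> = \<alpha> - of_int p / of_int q"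
  have q: "0 < real_of_int q" using pq by simp
  have pos: "0 < a * \<theta> * l" using a \<theta> l by simp
  have qd: "2 * a * \<theta> * l \<le> of_int q * \<delta>" "of_int q * \<delta> \<le> 4 * a * \<theta> * l" using \<alpha> by (simp_all add: \<delta>_def)
  have d: "0 < \<delta>"
  proof -
    have "0 < of_int q * \<delta>" using qd pos by linarith
    then show ?thesis using q by (simp add: zero_less_mult_iff)
  qed
  have q\<alpha>: "of_int q * \<alpha> = of_int p + of_int q * \<delta>" using q by (simp add: \<delta>_def algebra_simps)
  have shift: "of_int q * (of_int m * \<alpha> - t) = of_int m * of_int p - of_int q * t + of_int m * (of_int q * \<delta>)" for m :: int and t
    using arg_cong[OF q\<alpha>, of "\<lambda>u. of_int m * u"] by (simp add: algebra_simps)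
  have small: "\<bar>of_int m * (of_int q * \<delta>)\<bar> \<le> 4 * a * e" if "\<bar>of_int m\<bar> * (\<theta> * l) \<le> e" for m :: int and e
  proof -
    have "\<bar>of_int m * (of_int q * \<delta>)\<bar> = \<bar>of_int m\<bar> * (of_int q * \<delta>)" using q d by (simp add: abs_mult)
    also have "\<dots> \<le> \<bar>of_int m\<bar> * (4 * a * \<theta> * l)" using qd by (intro mult_left_mono) auto
    also have "\<dots> = 4 * a * (\<bar>of_int m\<bar> * (\<theta> * l))" by (simp add: mult_ac)
    also have "\<dots> \<le> 4 * a * e" using that a by (intro mult_left_mono) auto
    finally show ?thesis .
  qed
  \<comment> \<open>Undoing the factor \<open>q\<close> costs at most \<open>C / l\<close>, whence
    bounds proportional to \<open>l\<close> and not to \<open>\<theta> * l\<close>.\<close>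
  have lower: "l * k / C \<le> \<bar>t\<bar>" if "k \<le> \<bar>of_int q * t\<bar>" "0 \<le> k" for k t
  proof -
    have "(of_int q * l) * k \<le> C * \<bar>of_int q * t\<bar>" using that pq(3) C by (intro mult_mono) auto
    then have "of_int q * (l * k) \<le> of_int q * (C * \<bar>t\<bar>)" using q by (simp add: abs_mult mult_ac)
    then have "l * k \<le> C * \<bar>t\<bar>" using q by simp
    then show ?thesis using C by (simp add: pos_divide_le_eq mult_ac)
  qed
  have grid: "l / (8 * C) \<le> \<bar>of_int q' * \<alpha> - of_int p' - \<gamma>\<bar>" if "\<bar>of_int q'\<bar> * (\<theta> * l) \<le> b" for p' q' :: int
  proof -
    have e: "of_int q * (of_int q' * \<alpha> - of_int p' - \<gamma>) = - (of_int q * \<gamma> - of_int (q' * p - q * p')) + of_int q' * (of_int q * \<delta>)"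
      using shift[of q' "of_int p' + \<gamma>"] by (simp add: algebra_simps)
    \<comment> \<open>\<open>q * \<gamma>\<close> is at distance at least 1/4 from the integer
      \<open>q' * p - q * p'\<close>, and \<open>a * b \<le> 1/32\<close> limits the perturbation
      \<open>4 * a * b\<close> to 1/8.\<close>
    have "1/8 \<le> \<bar>of_int q * (of_int q' * \<alpha> - of_int p' - \<gamma>)\<bar>"
      unfolding e using small[OF that] pq(4)[rule_format, of "q' * p - q * p'"] ab by linarith
    then show ?thesis using lower[of "1/8"] by simp
  qed
  then show "\<bar>of_int q'\<bar> * (\<theta> * l) \<le> b \<Longrightarrow> l / (8 * C) \<le> \<bar>of_int q' * \<alpha> - of_int p' - \<gamma>\<bar>" .
  have "b * (\<theta> * l) < l / (8 * C)"
  proof -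
    have "8 * C * (b * (\<theta> * l)) = (16 * C * b * \<theta>) * l / 2" by simp
    also have "\<dots> \<le> 1 * l / 2" using \<theta>(2) l by (intro divide_right_mono mult_right_mono) auto
    also have "\<dots> < l" using l by simp
    finally show ?thesis using C by (simp add: pos_less_divide_eq mult_ac)
  qed
  then show "grid_avoids \<gamma> b (\<theta> * l) \<alpha>" unfolding grid_avoids_def using grid by (meson less_le_trans)
  show "lattice_avoids a (\<theta> * l) \<alpha>"
    unfolding lattice_avoids_def
  proof (intro allI impI)
    fix p' q' :: int assume q': "q' \<noteq> 0" "\<bar>of_int q'\<bar> * (\<theta> * l) \<le> a"
    have e: "of_int q * (of_int q' * \<alpha> - of_int p') = of_int (q' * p - q * p') + of_int q' * (of_int q * \<delta>)"
      using shift[of q' "of_int p'"] by simp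
    show "a * (\<theta> * l) < \<bar>of_int q' * \<alpha> - of_int p'\<bar>"
    proof (cases "q' * p = q * p'")
      case False
      then have "1 \<le> \<bar>q' * p - q * p'\<bar>" by linarith
      then have "1 \<le> \<bar>real_of_int (q' * p - q * p')\<bar>" by linarith
      moreover have "4 * a * a \<le> 1/4" using mult_mono[of a "1/4" a "1/4"] a by simp
      ultimately have "1/2 \<le> \<bar>of_int q * (of_int q' * \<alpha> - of_int p')\<bar>"
        unfolding e using small[OF q'(2)] by linarith
      then have "l / (2 * C) \<le> \<bar>of_int q' * \<alpha> - of_int p'\<bar>" using lower[of "1/2"] by simp
      moreover have "a * (\<theta> * l) < l / (2 * C)"
      proof -
        have "2 * C * (a * (\<theta> * l)) = (4 * C * a * \<theta>) * l / 2" by simp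
        also have "\<dots> \<le> 1 * l / 2" using \<theta>(3) l by (intro divide_right_mono mult_right_mono) auto
        also have "\<dots> < l" using l by simp
        finally show ?thesis using C by (simp add: pos_less_divide_eq mult_ac)
      qed
      ultimately show ?thesis by linarith
    next
      case True
      then have "q dvd q' * p" by simp
      then have "q dvd q'" using pq(1) by (simp add: coprime_dvd_mult_left_iff coprime_commute)
      then have "\<bar>q\<bar> \<le> \<bar>q'\<bar>" using q'(1) by (rule dvd_imp_le_int[rotated])
      then have "real_of_int q \<le> \<bar>of_int q'\<bar>" using pq(2) by linarith
      moreover have "of_int q' * \<alpha> - of_int p' = of_int q' * \<delta>"
      proof -
        have "of_int q * (of_int q' * \<alpha> - of_int p') = of_int q * (of_int q' * \<delta>)" unfolding e using True by (simp add: mult_ac)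
        then show ?thesis using q by simp
      qed
      ultimately have "of_int q * \<delta> \<le> \<bar>of_int q' * \<alpha> - of_int p'\<bar>" using d by (simp add: abs_mult mult_right_mono)
      then show ?thesis using qd pos by (simp add: mult_ac)
    qed
  qed
  have "of_int q * (of_int q * \<delta>) \<le> of_int q * (4 * a * \<theta> * l)" using qd q by (intro mult_left_mono) auto
  also have "\<dots> = 4 * a * \<theta> * (of_int q * l)" by (simp add: mult_ac)
  also have "\<dots> \<le> 4 * a * \<theta> * C" using pq(3) a \<theta> by (intro mult_left_mono) auto
  finally have "\<delta> \<le> 4 * a * C * \<theta> / (of_int q)\<^sup>2" using q by (simp add: pos_le_divide_eq power2_eq_square mult_ac)
  then show "\<bar>\<alpha> - of_int p / of_int q\<bar> \<le> 4 * a * C * \<theta> / (of_int q)\<^sup>2" using d by (simp add: \<delta>_def)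
qed

text \<open>\<open>C\<close> is chosen before \<theta>: as \<theta> shrinks, the rational
  approximation improves proportionally, while the inhomogeneous bound \<open>l / (8 * C)\<close>
  stays.\<close>

lemma good_interval_special:
  fixes a b \<gamma> :: real
  assumes a: "0 < a" "a \<le> 1/4" and b: "0 < b" and ab: "a * b \<le> 1/32"
  obtains C \<theta>\<^sub>0 :: real where "0 < C" "0 < \<theta>\<^sub>0"
    "\<And>\<theta> l x. 0 < \<theta> \<Longrightarrow> \<theta> \<le> \<theta>\<^sub>0 \<Longrightarrow> 0 < l \<Longrightarrow> l \<le> 1 \<Longrightarrow> good_interval \<gamma> a b l x \<Longrightarrow>
      \<exists>y. good_interval \<gamma> a b (\<theta> * l) y \<and> x \<le> y \<and> y + (\<theta> * l)\<^sup>2 \<le> x + l\<^sup>2 \<and>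
        (\<forall>\<alpha>\<in>{y..y + (\<theta> * l)\<^sup>2}.
          (\<exists>p q :: int. 0 < q \<and> \<bar>\<alpha> - of_int p / of_int q\<bar> \<le> 4 * a * C * \<theta> / (of_int q)\<^sup>2) \<and>
          (\<forall>p q :: int. \<bar>of_int q\<bar> * (\<theta> * l) \<le> b \<longrightarrow> l / (8 * C) \<le> \<bar>of_int q * \<alpha> - of_int p - \<gamma>\<bar>))"
proof -
  have a1: "a \<le> 1" using a by simp
  obtain C where C: "0 < C" and far: "\<And>l x. 0 < l \<Longrightarrow> l \<le> 1 \<Longrightarrow> good_interval \<gamma> a b l x \<Longrightarrow>
      \<exists>p q :: int. coprime p q \<and> 0 < q \<and> a < of_int q * l \<and> of_int q * l \<le> C \<and>
        \<bar>of_int p / of_int q - (x + l\<^sup>2 / 2)\<bar> \<le> l\<^sup>2 / 4 \<and> (\<forall>n::int. 1/4 \<le> \<bar>of_int q * \<gamma> - of_int n\<bar>)"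
    using ex_far_denominator[OF a(1) a1 b] by metis
  \<comment> \<open>The first two bounds keep the new interval inside the old one and at distance
    between \<open>D\<close> and \<open>2 * D\<close> from \<open>p / q\<close>; the last two are
    what \<open>special_point\<close> asks of \<theta>.\<close>
  define \<theta>\<^sub>0 where "\<theta>\<^sub>0 = min (min (1/16) (2 * a / C)) (min (1 / (16 * C * b)) (1 / (4 * C * a)))"
  have "0 < \<theta>\<^sub>0" using a b C by (simp add: \<theta>\<^sub>0_def)
  moreover have "\<exists>y. good_interval \<gamma> a b (\<theta> * l) y \<and> x \<le> y \<and> y + (\<theta> * l)\<^sup>2 \<le> x + l\<^sup>2 \<and>
        (\<forall>\<alpha>\<in>{y..y + (\<theta> * l)\<^sup>2}.
          (\<exists>p q :: int. 0 < q \<and> \<bar>\<alpha> - of_int p / of_int q\<bar> \<le> 4 * a * C * \<theta> / (of_int q)\<^sup>2) \<and>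
          (\<forall>p q :: int. \<bar>of_int q\<bar> * (\<theta> * l) \<le> b \<longrightarrow> l / (8 * C) \<le> \<bar>of_int q * \<alpha> - of_int p - \<gamma>\<bar>))"
    if \<theta>0: "0 < \<theta>" "\<theta> \<le> \<theta>\<^sub>0" and l: "0 < l" "l \<le> 1" and good: "good_interval \<gamma> a b l x" for \<theta> l x
  proof -
    have \<theta>: "\<theta> \<le> 1/16" "C * \<theta> \<le> 2 * a" "16 * C * b * \<theta> \<le> 1" "4 * C * a * \<theta> \<le> 1"
      using \<theta>0 a b C by (simp_all add: \<theta>\<^sub>0_def field_simps)
    obtain p q :: int where pq: "coprime p q" "0 < q" "a < of_int q * l" "of_int q * l \<le> C"
        "\<bar>of_int p / of_int q - (x + l\<^sup>2 / 2)\<bar> \<le> l\<^sup>2 / 4" "\<forall>n::int. 1/4 \<le> \<bar>of_int q * \<gamma> - of_int n\<bar>"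
      using far[OF l good] by blast
    have q: "0 < real_of_int q" using pq(2) by simp
    define D where "D = 2 * a * \<theta> * l / of_int q"
    define y where "y = of_int p / of_int q + D"
    have D0: "0 < D" using a \<theta>0 l q by (simp add: D_def)
    have qD: "of_int q * D = 2 * a * \<theta> * l" using q by (simp add: D_def)
    have lD: "(\<theta> * l)\<^sup>2 \<le> D"
    proof -
      have "of_int q * (\<theta> * l)\<^sup>2 = (of_int q * l) * \<theta> * (\<theta> * l)" by (simp add: power2_eq_square mult_ac)
      also have "\<dots> \<le> C * \<theta> * (\<theta> * l)" using pq(4) \<theta>0 l by (intro mult_right_mono) auto
      also have "\<dots> \<le> 2 * a * (\<theta> * l)" using \<theta>(2) \<theta>0 l by (intro mult_right_mono) auto
      also have "\<dots> = of_int q * D" using qD by simp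
      finally show ?thesis using q by simp
    qed
    have D8: "D \<le> l\<^sup>2 / 8"
    proof -
      have "of_int q * D = 2 * \<theta> * l * a" by (simp add: qD)
      also have "\<dots> \<le> 2 * \<theta> * l * (of_int q * l)" using pq(3) \<theta>0 l by (intro mult_left_mono) auto
      also have "\<dots> \<le> 2 * (1/16) * l * (of_int q * l)" using \<theta>(1) l q by (intro mult_right_mono) auto
      also have "\<dots> = of_int q * (l\<^sup>2 / 8)" by (simp add: power2_eq_square)
      finally show ?thesis using q by simp
    qed
    have sub: "x \<le> y" "y + (\<theta> * l)\<^sup>2 \<le> x + l\<^sup>2"
      using pq(5) lD D8 D0 zero_le_power2[of l] unfolding y_def abs_le_iff by linarith+
    have pt: "2 * a * \<theta> * l \<le> of_int q * (\<alpha> - of_int p / of_int q)"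
      "of_int q * (\<alpha> - of_int p / of_int q) \<le> 4 * a * \<theta> * l" if "\<alpha> \<in> {y..y + (\<theta> * l)\<^sup>2}" for \<alpha>
    proof -
      have "D \<le> \<alpha> - of_int p / of_int q" "\<alpha> - of_int p / of_int q \<le> 2 * D"
        using that lD by (auto simp: y_def)
      then have "of_int q * D \<le> of_int q * (\<alpha> - of_int p / of_int q)"
        "of_int q * (\<alpha> - of_int p / of_int q) \<le> of_int q * (2 * D)"
        using q by (intro mult_left_mono; simp)+
      then show "2 * a * \<theta> * l \<le> of_int q * (\<alpha> - of_int p / of_int q)"
        "of_int q * (\<alpha> - of_int p / of_int q) \<le> 4 * a * \<theta> * l"
        using qD by linarith+
    qed
    note sp = special_point[OF l(1) a b ab C \<theta>0(1) \<theta>(3,4) pq(1,2,4,6) pt]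
    have "good_interval \<gamma> a b (\<theta> * l) y" unfolding good_interval_def using sp(1,2) by blast
    then show ?thesis using sub sp(3,4) pq(2) by blast
  qed
  ultimately show thesis using that C by blast
qed

section \<open>The Cantor set\<close>

text \<open>Let \<open>Suc n\<close> be the first index with
  \<open>\<bar>q\<bar> * l (Suc n) \<le> b\<close>; it cannot be 0 because \<open>b < 1\<close>.
  Then \<open>l n\<close> exceeds \<open>b / \<bar>q\<bar>\<close>. Since \<open>far\<close> bounds
  from below by \<open>l n\<close>, the unbounded ratio of consecutive scales never enters the
  constant.\<close>

lemma inhom_BadI:
  fixes l :: "nat \<Rightarrow> real"
  assumes l0: "l 0 = 1" and lim: "l \<longlonglongrightarrow> 0" and b: "0 < b" "b < 1" and c: "0 < c"
    and far: "\<And>n p q. \<bar>of_int q\<bar> * l (Suc n) \<le> b \<Longrightarrow> c * l n \<le> \<bar>of_int q * \<alpha> - of_int p - \<gamma>\<bar>"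
  shows "\<alpha> \<in> inhom_Bad \<gamma>"
proof -
  have "c * b / (of_int q)\<^sup>2 < \<bar>\<alpha> - (of_int p + \<gamma>) / of_int q\<bar>" if q: "q \<noteq> 0" for p q :: int
  proof -
    have q1: "1 \<le> \<bar>real_of_int q\<bar>" using q by linarith
    have "(\<lambda>n. \<bar>real_of_int q\<bar> * l n) \<longlonglongrightarrow> \<bar>of_int q\<bar> * 0" by (intro tendsto_intros lim)
    then have "eventually (\<lambda>n. \<bar>real_of_int q\<bar> * l n < b) sequentially"
      by (rule order_tendstoD) (use b in simp)
    then have "\<exists>n. \<bar>real_of_int q\<bar> * l n \<le> b" by (auto simp: eventually_sequentially intro: less_imp_le)
    then obtain k where k: "\<bar>real_of_int q\<bar> * l k \<le> b" "\<forall>m<k. \<not> \<bar>real_of_int q\<bar> * l m \<le> b"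
      using exists_least_iff[of "\<lambda>n. \<bar>real_of_int q\<bar> * l n \<le> b"] by blast
    have "k \<noteq> 0"
    proof
      assume "k = 0"
      then show False using k(1) l0 b q1 by simp
    qed
    then obtain n where n: "k = Suc n" using not0_implies_Suc by blast
    have "b < \<bar>real_of_int q\<bar> * l n" using k(2) n by auto
    then have "c * b < c * (\<bar>real_of_int q\<bar> * l n)" using c by simp
    also have "\<dots> = \<bar>of_int q\<bar> * (c * l n)" by (simp add: mult_ac)
    also have "\<dots> \<le> \<bar>of_int q\<bar> * \<bar>of_int q * \<alpha> - of_int p - \<gamma>\<bar>"
      using far[of q n p] k(1) n by (intro mult_left_mono) auto
    also have "of_int q * \<alpha> - of_int p - \<gamma> = of_int q * (\<alpha> - (of_int p + \<gamma>) / of_int q)"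
      using q by (simp add: right_diff_distrib)
    also have "\<bar>of_int q\<bar> * \<bar>of_int q * (\<alpha> - (of_int p + \<gamma>) / of_int q)\<bar> = \<bar>\<alpha> - (of_int p + \<gamma>) / of_int q\<bar> * (of_int q)\<^sup>2"
      unfolding abs_mult power2_abs[of "of_int q", symmetric] power2_eq_square by (simp only: mult_ac)
    finally show ?thesis using q by (simp add: pos_divide_less_eq)
  qed
  then show ?thesis using b c unfolding inhom_Bad_def by (auto intro!: exI[of _ "c * b"])
qed

lemma dist_Ints_pos:
  fixes \<gamma> :: real
  assumes "\<gamma> \<notin> \<int>"
  obtains g where "0 < g" "\<And>p::int. g \<le> \<bar>of_int p + \<gamma>\<bar>"
proof
  have "frac \<gamma> \<noteq> 0" using assms by (simp add: frac_eq_0_iff)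
  then show "0 < min (frac \<gamma>) (1 - frac \<gamma>)" using frac_lt_1[of \<gamma>] frac_ge_0[of \<gamma>] by simp
  show "min (frac \<gamma>) (1 - frac \<gamma>) \<le> \<bar>of_int p + \<gamma>\<bar>" for p
  proof (cases "0 \<le> p + \<lfloor>\<gamma>\<rfloor>")
    case True
    then have "0 \<le> real_of_int (p + \<lfloor>\<gamma>\<rfloor>)" by linarith
    then show ?thesis unfolding frac_def by simp
  next
    case False
    then have "real_of_int (p + \<lfloor>\<gamma>\<rfloor>) \<le> -1" by linarith
    then show ?thesis unfolding frac_def by simp
  qed
qed

text \<open>At scale 1 only \<open>q = 0\<close> is in range, where lattice avoidance is void and
  grid avoidance says that \<gamma> is more than \<open>b\<close> away from the integers.\<close>

lemma good_interval_unit: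
  assumes "a < 1" "b < 1" "\<And>p::int. b < \<bar>of_int p + \<gamma>\<bar>"
  shows "good_interval \<gamma> a b 1 x"
proof -
  have z: "q = 0" if "\<bar>real_of_int q\<bar> \<le> e" "e < 1" for q e using that by linarith
  have "b < \<bar>of_int q * \<alpha> - of_int p - \<gamma>\<bar>" if "\<bar>real_of_int q\<bar> \<le> b" for \<alpha> p q
    using z[OF that assms(2)] assms(3)[of p] by simp
  then show ?thesis
    unfolding good_interval_def lattice_avoids_def grid_avoids_def using z[OF _ assms(1)] by auto
qed

lemma hausdorff_measure_inhom_Bad_diff_Bad:
  fixes \<gamma> s :: real
  assumes \<gamma>: "\<gamma> \<notin> \<int>" and s: "0 < s" "s < 1"
  shows "hausdorff_measure s (inhom_Bad \<gamma> - Bad) \<noteq> 0"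
proof -
  obtain g where g: "0 < g" "\<And>p::int. g \<le> \<bar>of_int p + \<gamma>\<bar>" using dist_Ints_pos[OF \<gamma>] by blast
  obtain r :: nat where r: "r \<ge> 6" "1 / (6 * (real r)\<^sup>2) < g" "(real r)\<^sup>2 powr s < real (r\<^sup>2 - (4 * r + 4))"
    using ex_branching_number[OF s(2) g(1)] by blast
  define a where "a = 1 / (2 * real r)"
  define b where "b = 1 / (6 * (real r)\<^sup>2)"
  define m where "m = r\<^sup>2 - (4 * r + 4)"
  have r6: "6 \<le> real r" using r(1) by simp
  have r36: "36 \<le> (real r)\<^sup>2" using power_mono[OF r6, of 2] by simp
  have a: "0 < a" "a \<le> 1/4" "a < 1" using r6 by (auto simp: a_def field_simps)
  have "b \<le> 1 / (6 * 36)" unfolding b_def using r36 r(1) by (intro divide_left_mono) auto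
  then have b: "0 < b" "b < 1" "b \<le> 1/8" using r6 by (auto simp: b_def)
  have ab: "a * b \<le> 1/32" using mult_mono[of a "1/4" b "1/8"] a b by simp
  have r2: "2 \<le> r" using r(1) by simp
  obtain C \<theta>\<^sub>0 :: real where C: "0 < C" and \<theta>\<^sub>0: "0 < \<theta>\<^sub>0" and special:
    "\<And>\<theta> l x. 0 < \<theta> \<Longrightarrow> \<theta> \<le> \<theta>\<^sub>0 \<Longrightarrow> 0 < l \<Longrightarrow> l \<le> 1 \<Longrightarrow> good_interval \<gamma> a b l x \<Longrightarrow>
      \<exists>y. good_interval \<gamma> a b (\<theta> * l) y \<and> x \<le> y \<and> y + (\<theta> * l)\<^sup>2 \<le> x + l\<^sup>2 \<and>
        (\<forall>\<alpha>\<in>{y..y + (\<theta> * l)\<^sup>2}.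
          (\<exists>p q :: int. 0 < q \<and> \<bar>\<alpha> - of_int p / of_int q\<bar> \<le> 4 * a * C * \<theta> / (of_int q)\<^sup>2) \<and>
          (\<forall>p q :: int. \<bar>of_int q\<bar> * (\<theta> * l) \<le> b \<longrightarrow> l / (8 * C) \<le> \<bar>of_int q * \<alpha> - of_int p - \<gamma>\<bar>))"
    by (rule good_interval_special[OF a(1,2) b(1) ab, of \<gamma>]) (rule that; blast)
  \<comment> \<open>Tends to 0, so that every candidate constant for \<open>Bad\<close> is
    eventually defeated; the rate is immaterial, as the schedule waits long enough.\<close>
  define \<theta> where "\<theta> j = min \<theta>\<^sub>0 (1/2) / real (Suc j)" for j
  have \<theta>: "0 < \<theta> j" "\<theta> j \<le> \<theta>\<^sub>0" "\<theta> j \<le> 1/2" for j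
  proof -
    show "0 < \<theta> j" using \<theta>\<^sub>0 by (simp add: \<theta>_def)
    have "\<theta> j \<le> min \<theta>\<^sub>0 (1/2) / 1" unfolding \<theta>_def using \<theta>\<^sub>0 by (intro divide_left_mono) auto
    then show "\<theta> j \<le> \<theta>\<^sub>0" "\<theta> j \<le> 1/2" by simp_all
  qed
  have \<theta>_lim: "\<theta> \<longlonglongrightarrow> 0" unfolding \<theta>_def by real_asymp
  define \<rho> where "\<rho> = real m * (1 / real r)\<^sup>2 powr s"
  have \<rho>: "1 < \<rho>"
  proof -
    have "(real r)\<^sup>2 powr s * (1 / real r)\<^sup>2 powr s = ((real r)\<^sup>2 * (1 / real r)\<^sup>2) powr s" by (rule powr_mult[symmetric])
    also have "(real r)\<^sup>2 * (1 / real r)\<^sup>2 = 1" using r6 by (simp add: power_divide)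
    finally have "(real r)\<^sup>2 powr s * (1 / real r)\<^sup>2 powr s = 1" by simp
    moreover have "(real r)\<^sup>2 powr s * (1 / real r)\<^sup>2 powr s < real m * (1 / real r)\<^sup>2 powr s"
      unfolding m_def using r6 by (intro mult_strict_right_mono r(3)) simp
    ultimately show ?thesis by (simp add: \<rho>_def)
  qed
  \<comment> \<open>A special step has one child, so it multiplies \<open>W\<close> by the length
    factor alone.\<close>
  have \<phi>: "0 < (\<theta> j)\<^sup>2 powr s" for j using \<theta>(1)[of j] by simp
  obtain sp :: "nat \<Rightarrow> bool" and j :: "nat \<Rightarrow> nat" and W :: "nat \<Rightarrow> real"
    where W: "W 0 = 1" "\<And>n. 1 \<le> W n" "\<And>n. W (Suc n) = W n * (if sp n then (\<theta> (j n))\<^sup>2 powr s else \<rho>)"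
      and hit: "\<And>k. \<exists>n. sp n \<and> j n = k"
    by (rule schedule_exists[OF \<rho>, of "\<lambda>j. (\<theta> j)\<^sup>2 powr s", OF \<phi>]) (rule that)
  define f where "f n = (if sp n then \<theta> (j n) else 1 / real r)" for n
  define M where "M n = (if sp n then 1 else m)" for n
  define l where "l n = (\<Prod>i<n. f i)" for n
  have f: "0 < f n" "f n \<le> 1/2" for n
    using \<theta>(1)[of "j n"] \<theta>(3)[of "j n"] r6 by (simp_all add: f_def)
  have l0: "l 0 = 1" and lS: "l (Suc n) = f n * l n" for n by (simp_all add: l_def mult.commute)
  have l_pos: "0 < l n" for n unfolding l_def by (intro prod_pos f)
  have l_le: "l n \<le> (1/2) ^ n" for n
  proof (induction n)
    case (Suc n)
    then show ?case unfolding lS power_Suc by (intro mult_mono f less_imp_le[OF l_pos]) auto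
  qed (simp add: l0)
  have l1: "l n \<le> 1" for n using l_le[of n] power_le_one[of "1/2::real" n] by simp
  have l_lim: "l \<longlonglongrightarrow> 0"
    by (rule tendsto_sandwich[of "\<lambda>_. 0" _ _ "\<lambda>n. (1/2) ^ n"])
      (auto intro!: always_eventually less_imp_le[OF l_pos] l_le LIMSEQ_power_zero)
  \<comment> \<open>\<open>b / r\<close> comes from grid avoidance after a regular step,
    \<open>1 / (8 * C)\<close> from a special step; neither involves \<theta>.\<close>
  define c where "c = min (b / r) (1 / (8 * C))"
  have c: "0 < c" "c \<le> b / r" "c \<le> 1 / (8 * C)" using b C r6 by (auto simp: c_def)
  define near where "near n \<alpha> \<longleftrightarrow>
      (sp n \<longrightarrow> (\<exists>p q :: int. 0 < q \<and> \<bar>\<alpha> - of_int p / of_int q\<bar> \<le> 4 * a * C * \<theta> (j n) / (of_int q)\<^sup>2))" for n \<alpha>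
  define far where "far n \<alpha> \<longleftrightarrow>
      (\<forall>p q :: int. \<bar>of_int q\<bar> * l (Suc n) \<le> b \<longrightarrow> c * l n \<le> \<bar>of_int q * \<alpha> - of_int p - \<gamma>\<bar>)" for n \<alpha>
  \<comment> \<open>\<open>near\<close> and \<open>far\<close> concern the step that leads to a
    node, hence the shift \<open>n = Suc k\<close> and no such demand on the root.\<close>
  define P where "P n x \<longleftrightarrow> good_interval \<gamma> a b (l n) x \<and>
      (\<forall>k. n = Suc k \<longrightarrow> (\<forall>\<alpha>\<in>{x..x + (l n)\<^sup>2}. near k \<alpha> \<and> far k \<alpha>))" for n x
  have children: "\<exists>D. finite D \<and> card D = M n \<and>
      (\<forall>y\<in>D. P (Suc n) y \<and> x \<le> y \<and> y + (l (Suc n))\<^sup>2 \<le> x + (l n)\<^sup>2) \<and>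
      (\<forall>y\<in>D. \<forall>z\<in>D. y \<noteq> z \<longrightarrow> (l (Suc n))\<^sup>2 \<le> \<bar>y - z\<bar>)" if "P n x" for n x
  proof -
    have good: "good_interval \<gamma> a b (l n) x" using that by (simp add: P_def)
    show ?thesis
    proof (cases "sp n")
      case True
      have lSn: "l (Suc n) = \<theta> (j n) * l n" using True by (simp add: lS f_def)
      have cl: "c * l n \<le> l n / (8 * C)" using mult_right_mono[OF c(3) less_imp_le[OF l_pos[of n]]] by simp
      obtain y where y: "good_interval \<gamma> a b (l (Suc n)) y" "x \<le> y" "y + (l (Suc n))\<^sup>2 \<le> x + (l n)\<^sup>2"
        "\<And>\<alpha>. \<alpha> \<in> {y..y + (l (Suc n))\<^sup>2} \<Longrightarrow>
          (\<exists>p q :: int. 0 < q \<and> \<bar>\<alpha> - of_int p / of_int q\<bar> \<le> 4 * a * C * \<theta> (j n) / (of_int q)\<^sup>2) \<and>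
          (\<forall>p q :: int. \<bar>of_int q\<bar> * l (Suc n) \<le> b \<longrightarrow> l n / (8 * C) \<le> \<bar>of_int q * \<alpha> - of_int p - \<gamma>\<bar>)"
        using special[OF \<theta>(1,2) l_pos l1 good, of "j n"] unfolding lSn by blast
      have "near n \<alpha> \<and> far n \<alpha>" if "\<alpha> \<in> {y..y + (l (Suc n))\<^sup>2}" for \<alpha>
        using y(4)[OF that] cl unfolding near_def far_def by (meson order_trans)
      then have "P (Suc n) y" using y(1) by (simp add: P_def)
      then show ?thesis using y(2,3) True by (intro exI[of _ "{y}"]) (simp add: M_def)
    next
      case False
      have lSn: "l (Suc n) = l n / r" using False by (simp add: lS f_def)
      obtain D where D: "finite D" "card D = r\<^sup>2 - (4 * r + 4)"
        "\<And>y. y \<in> D \<Longrightarrow> good_interval \<gamma> a b (l (Suc n)) y \<and> x \<le> y \<and> y + (l (Suc n))\<^sup>2 \<le> x + (l n)\<^sup>2"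
        "\<And>y z. y \<in> D \<Longrightarrow> z \<in> D \<Longrightarrow> y \<noteq> z \<Longrightarrow> (l (Suc n))\<^sup>2 \<le> \<bar>y - z\<bar>"
        using good_interval_split[OF l_pos l1 r2 a_def b_def good] unfolding lSn by blast
      have "P (Suc n) y" if "y \<in> D" for y
      proof -
        have "near n \<alpha> \<and> far n \<alpha>" if "\<alpha> \<in> {y..y + (l (Suc n))\<^sup>2}" for \<alpha>
        proof -
          have "grid_avoids \<gamma> b (l (Suc n)) \<alpha>" using D(3)[OF \<open>y \<in> D\<close>] that by (simp add: good_interval_def)
          moreover have "c * l n \<le> b * l (Suc n)"
            using mult_right_mono[OF c(2) less_imp_le[OF l_pos[of n]]] by (simp add: lSn)
          ultimately have "far n \<alpha>" unfolding far_def grid_avoids_def by (meson less_imp_le order_trans)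
          then show ?thesis using False by (simp add: near_def)
        qed
        then show ?thesis using D(3)[OF that] by (simp add: P_def)
      qed
      then show ?thesis using D False by (intro exI[of _ D]) (simp add: M_def m_def)
    qed
  qed
  define ch where "ch n x = (SOME D. finite D \<and> card D = M n \<and>
      (\<forall>y\<in>D. P (Suc n) y \<and> x \<le> y \<and> y + (l (Suc n))\<^sup>2 \<le> x + (l n)\<^sup>2) \<and>
      (\<forall>y\<in>D. \<forall>z\<in>D. y \<noteq> z \<longrightarrow> (l (Suc n))\<^sup>2 \<le> \<bar>y - z\<bar>))" for n x
  have ch: "finite (ch n x) \<and> card (ch n x) = M n \<and>
      (\<forall>y\<in>ch n x. P (Suc n) y \<and> x \<le> y \<and> y + (l (Suc n))\<^sup>2 \<le> x + (l n)\<^sup>2) \<and>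
      (\<forall>y\<in>ch n x. \<forall>z\<in>ch n x. y \<noteq> z \<longrightarrow> (l (Suc n))\<^sup>2 \<le> \<bar>y - z\<bar>)" if "P n x" for n x
    unfolding ch_def by (rule someI_ex[OF children[OF that]])
  have "b < \<bar>of_int p + \<gamma>\<bar>" for p :: int using g(2)[of p] r(2) by (simp add: b_def)
  then have root: "P 0 0" using good_interval_unit[OF a(3) b(2)] by (simp add: P_def l0)
  interpret interval_tree "\<lambda>n. (l n)\<^sup>2" M P ch 0
  proof
    show "0 < (l n)\<^sup>2" for n using l_pos[of n] by simp
  qed (use root ch in blast)+
  have W_eq: "W n = real (\<Prod>i<n. M i) * (l n)\<^sup>2 powr s" for n
  proof (induction n)
    case (Suc n)
    have "(l (Suc n))\<^sup>2 powr s = (f n)\<^sup>2 powr s * (l n)\<^sup>2 powr s"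
      by (simp add: lS power_mult_distrib powr_mult)
    then show ?case using W(3)[of n] Suc by (simp add: M_def f_def \<rho>_def mult_ac)
  qed (simp add: W l0)
  \<comment> \<open>A special step does not change the number of nodes, so there the product equals
    \<open>W (Suc n)\<close>; a regular step costs the fixed factor
    \<open>(1 / r)\<^sup>2 powr s\<close>. The bound is therefore uniform although \<theta> tends to
    0.\<close>
  have mass: "(1 / real r)\<^sup>2 powr s \<le> real (\<Prod>i<n. M i) * (l (Suc n))\<^sup>2 powr s" for n
  proof (cases "sp n")
    case True
    have "(1 / real r)\<^sup>2 powr s \<le> 1 powr s"
      using r6 s by (intro powr_mono2) (auto simp: power_le_one)
    also have "\<dots> \<le> W (Suc n)" using W(2)[of "Suc n"] by simp
    also have "\<dots> = real (\<Prod>i<n. M i) * (l (Suc n))\<^sup>2 powr s" using True by (simp only: W_eq) (simp add: M_def)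
    finally show ?thesis .
  next
    case False
    have "1 * (1 / real r)\<^sup>2 powr s \<le> W n * (1 / real r)\<^sup>2 powr s" by (intro mult_right_mono W(2)) simp
    also have "\<dots> = real (\<Prod>i<n. M i) * (l (Suc n))\<^sup>2 powr s"
      using False unfolding W_eq lS f_def by (simp only: power_mult_distrib powr_mult if_False) (simp add: mult_ac)
    finally show ?thesis by simp
  qed
  have "hausdorff_measure s limit_set \<noteq> 0"
  proof (rule hausdorff_measure_limit_set[OF s(1) _ mass])
    show "0 < (1 / real r)\<^sup>2 powr s" using r6 by simp
    show "(l (Suc n))\<^sup>2 \<le> (l n)\<^sup>2" for n
    proof (rule power_mono)
      show "l (Suc n) \<le> l n" using mult_right_mono[of "f n" 1 "l n"] f(2)[of n] l_pos[of n] by (simp add: lS)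
    qed (use l_pos[of "Suc n"] in simp)
    show "(\<lambda>n. (l n)\<^sup>2) \<longlonglongrightarrow> 0" using tendsto_power[OF l_lim, of 2] by simp
  qed
  moreover have "limit_set \<subseteq> inhom_Bad \<gamma> - Bad"
  proof
    fix \<alpha> assume \<alpha>: "\<alpha> \<in> limit_set"
    have nf: "near n \<alpha> \<and> far n \<alpha>" for n using limit_set_P[OF \<alpha>, of "Suc n"] by (auto simp: P_def)
    have "\<alpha> \<in> inhom_Bad \<gamma>"
      using nf unfolding far_def by (intro inhom_BadI[OF l0 l_lim b(1,2) c(1)]) blast
    moreover have "\<alpha> \<notin> Bad"
    proof
      assume "\<alpha> \<in> Bad"
      then obtain e where e: "0 < e" "\<And>p q :: int. q \<noteq> 0 \<Longrightarrow> e / (of_int q)\<^sup>2 < \<bar>\<alpha> - of_int p / of_int q\<bar>"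
        unfolding Bad_def by blast
      have "(\<lambda>k. 4 * a * C * \<theta> k) \<longlonglongrightarrow> 4 * a * C * 0" by (intro tendsto_intros \<theta>_lim)
      then have "eventually (\<lambda>k. 4 * a * C * \<theta> k < e) sequentially"
        by (rule order_tendstoD) (use e in simp)
      then obtain k where k: "4 * a * C * \<theta> k < e" by (auto simp: eventually_sequentially)
      obtain n where n: "sp n" "j n = k" using hit by blast
      obtain p q :: int where pq: "0 < q" "\<bar>\<alpha> - of_int p / of_int q\<bar> \<le> 4 * a * C * \<theta> k / (of_int q)\<^sup>2"
        using nf[of n] n unfolding near_def by blast
      have "4 * a * C * \<theta> k / (of_int q)\<^sup>2 \<le> e / (of_int q)\<^sup>2" using k by (intro divide_right_mono) auto
      then show False using pq e(2)[of q p] by simp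
    qed
    ultimately show "\<alpha> \<in> inhom_Bad \<gamma> - Bad" by blast
  qed
  ultimately show ?thesis using hausdorff_measure_mono by (metis bot.extremum_uniqueI bot_ennreal)
qed

theorem theorem1p1:
  fixes \<gamma> :: real
  assumes "\<gamma> \<notin> \<int>"
  shows "hausdorff_dim (inhom_Bad \<gamma> - Bad) = 1"
  using assms by (intro hausdorff_dim_eq_1 hausdorff_measure_inhom_Bad_diff_Bad)

end
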